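(* Let $n\geq 3$ and $q\in(1,\frac{n}{n-1})$. (1) For any $x\in\mathbb{B}^{n}\setminus\{0\}$, any $l\in\mathbb{S}^{n-1}$ and any unit vector $t_{x}\in\mathbb{R}^{n}$ with $\langle t_{x},\frac{x}{|x|}\rangle=0$, $$\mathbf{C}_{\mathbb{B}^{n},q}\big(x;\pm\tfrac{x}{|x|}\big)\leq\mathbf{C}_{\mathbb{B}^{n},q}(x;l)\leq\mathbf{C}_{\mathbb{B}^{n},q}(x;t_{x})=\mathbf{C}_{\mathbb{B}^{n},q}(x).$$ (2) For any $x\in\mathbb{H}^{n}$, any $l\in\mathbb{S}^{n-1}$ and any unit vector $t_{e_n}\in\mathbb{R}^{n}$ with $\langle t_{e_n},e_n\rangle=0$, $$\mathbf{C}_{\mathbb{H}^{n},q}(x;\pm e_{n})\leq\mathbf{C}_{\mathbb{H}^{n},q}(x;l)\leq\mathbf{C}_{\mathbb{H}^{n},q}(x;t_{e_{n}})=\mathbf{C}_{\mathbb{H}^{n},q}(x).$$ Here $\pm$ means the statement holds for both choices of sign.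
   Context: $\langle\cdot,\cdot\rangle$ and $|\cdot|$ are the Euclidean inner product and norm on $\mathbb{R}^n$; $\mathbb{B}^n=\{|x|<1\}$, $\mathbb{S}^{n-1}=\{|x|=1\}$, $\mathbb{H}^n=\{x=(x',x_n): x'\in\mathbb{R}^{n-1},\,x_n>0\}$, $e_n=(0,\ldots,0,1)$; $\partial\mathbb{H}^n$ is identified with $\mathbb{R}^{n-1}$. $\sigma$ is the surface measure on $\mathbb{S}^{n-1}$ normalized so that $\sigma(\mathbb{S}^{n-1})=1$, and $V_{n-1}$ is Lebesgue measure on $\mathbb{R}^{n-1}$. $L^p(\mathbb{S}^{n-1},\mathbb{R})$ and $L^p(\mathbb{R}^{n-1},\mathbb{R})$ are taken with respect to $\sigma$ and $V_{n-1}$ respectively. For $\phi\in L^p(\mathbb{S}^{n-1},\mathbb{R})$, $p\in[1,\infty]$, the Poisson–Szegő integral (for the hyperbolic Laplacian) is $$\mathcal{P}_{\mathbb{B}^n}[\phi](x)=\int_{\mathbb{S}^{n-1}}\Big(\frac{1-|x|^2}{|x-\zeta|^2}\Big)^{n-1}\phi(\zeta)\,d\sigma(\zeta),\quad x\in\mathbb{B}^n.$$ For $\phi\in L^p(\mathbb{R}^{n-1},\mathbb{R})$, $$\mathcal{P}_{\mathbb{H}^n}[\phi](x)=c_n\int_{\mathbb{R}^{n-1}}\Big(\frac{x_n}{|x'-y'|^2+x_n^2}\Big)^{n-1}\phi(y')\,dV_{n-1}(y'),\quad x\in\mathbb{H}^n,\qquad c_n=\frac{2^{n-2}\Gamma(n/2)}{\pi^{n/2}}.$$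 Let $\Omega=\mathbb{B}^n$ or $\mathbb{H}^n$, $q\in[1,\infty]$ and $p$ its conjugate exponent ($1/p+1/q=1$, $1/\infty=0$). For $x\in\Omega$ and $l\in\mathbb{S}^{n-1}$, $\mathbf{C}_{\Omega,q}(x)$ and $\mathbf{C}_{\Omega,q}(x;l)$ denote the smallest constants such that $$|\nabla u(x)|\leq \mathbf{C}_{\Omega,q}(x)\|\phi\|_{L^p(\partial\Omega,\mathbb{R})},\qquad |\langle\nabla u(x),l\rangle|\leq \mathbf{C}_{\Omega,q}(x;l)\|\phi\|_{L^p(\partial\Omega,\mathbb{R})}$$ hold for all $\phi\in L^p(\partial\Omega,\mathbb{R})$ with $u=\mathcal{P}_\Omega[\phi]$. *)

theory Defs
  imports "HOL-Analysis.Analysis"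
begin

text \<open>The Lebesgue space \<open>L\<^sup>p\<close> of real-valued functions and its norm, for finite \<open>p \<ge> 1\<close>;
  functions are not identified almost everywhere.\<close>

definition Lp_space :: "'b measure \<Rightarrow> real \<Rightarrow> ('b \<Rightarrow> real) set" where
  "Lp_space M p = {f \<in> borel_measurable M. integrable M (\<lambda>y. \<bar>f y\<bar> powr p)}"

definition Lp_norm :: "'b measure \<Rightarrow> real \<Rightarrow> ('b \<Rightarrow> real) \<Rightarrow> real" where
  "Lp_norm M p f = (\<integral>y. \<bar>f y\<bar> powr p \<partial>M) powr (1 / p)"

text \<open>The conjugate exponent, solving \<open>1 / p + 1 / q = 1\<close>, for \<open>1 < q < \<infinity>\<close>.\<close>

definition conj_exp :: "real \<Rightarrow> real" where
  "conj_exp q = q / (q - 1)"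

lemma conj_exp_conjugate: "1 < q \<Longrightarrow> 1 / conj_exp q + 1 / q = 1"
  by (simp add: conj_exp_def field_simps)

definition gradient :: "('a::real_inner \<Rightarrow> real) \<Rightarrow> 'a \<Rightarrow> 'a" where
  "gradient u x = (THE D. GDERIV u x :> D)"

text \<open>Polar coordinates describe the normalized surface measure of a Borel subset \<open>A\<close> of the unit
  sphere as the volume of the cone \<open>{r \<zeta> | 0 < r < 1, \<zeta> \<in> A}\<close> divided by the volume of the unit
  ball, i.e. as the image of the uniform distribution on the ball under radial projection.
  The restriction only cuts off a null set, the centre of the ball being projected to \<open>0\<close>.\<close>

definition sphere_measure :: "'a::euclidean_space measure" where
  "sphere_measure =
     restrict_space (distr (uniform_measure lborel (ball 0 1)) borel (\<lambda>x. x /\<^sub>R norm x)) (sphere 0 1)"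

definition poisson_ball :: "('a \<Rightarrow> real) \<Rightarrow> 'a::euclidean_space \<Rightarrow> real" where
  "poisson_ball \<phi> x =
     (\<integral>\<zeta>. ((1 - (norm x)\<^sup>2) / (norm (x - \<zeta>))\<^sup>2) ^ (DIM('a) - 1) * \<phi> \<zeta> \<partial>sphere_measure)"

text \<open>For the half-space, \<open>\<real>\<^sup>n\<close> is the product of \<open>\<real>\<^sup>n\<^sup>-\<^sup>1\<close> and \<open>\<real>\<close>, whose product norm is the
  Euclidean one; a point \<open>x\<close> has \<open>x' = fst x\<close> and \<open>x\<^sub>n = snd x\<close>.\<close>

definition upper_halfspace :: "('a::euclidean_space \<times> real) set" where
  "upper_halfspace = {x. snd x > 0}"

definition poisson_halfspace_const :: "nat \<Rightarrow> real" where
  "poisson_halfspace_const n = 2 ^ (n - 2) * Gamma (real n / 2) / pi powr (real n / 2)"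

definition poisson_halfspace :: "('a \<Rightarrow> real) \<Rightarrow> 'a::euclidean_space \<times> real \<Rightarrow> real" where
  "poisson_halfspace \<phi> x = poisson_halfspace_const DIM('a \<times> real) *
     (\<integral>y. (snd x / ((norm (fst x - y))\<^sup>2 + (snd x)\<^sup>2)) ^ (DIM('a \<times> real) - 1) * \<phi> y \<partial>lborel)"

text \<open>The best constants for an integral operator \<open>P\<close> acting on \<open>L\<^sup>p M\<close>, where \<open>p\<close> is
  conjugate to \<open>q\<close>.\<close>

definition grad_const ::
  "'b measure \<Rightarrow> (('b \<Rightarrow> real) \<Rightarrow> 'a::real_inner \<Rightarrow> real) \<Rightarrow> real \<Rightarrow> 'a \<Rightarrow> real" where
  "grad_const M P q x = (LEAST C. \<forall>\<phi>\<in>Lp_space M (conj_exp q).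
     norm (gradient (P \<phi>) x) \<le> C * Lp_norm M (conj_exp q) \<phi>)"

definition grad_const_dir ::
  "'b measure \<Rightarrow> (('b \<Rightarrow> real) \<Rightarrow> 'a::real_inner \<Rightarrow> real) \<Rightarrow> real \<Rightarrow> 'a \<Rightarrow> 'a \<Rightarrow> real" where
  "grad_const_dir M P q x l = (LEAST C. \<forall>\<phi>\<in>Lp_space M (conj_exp q).
     \<bar>gradient (P \<phi>) x \<bullet> l\<bar> \<le> C * Lp_norm M (conj_exp q) \<phi>)"

definition C_ball :: "real \<Rightarrow> 'a::euclidean_space \<Rightarrow> real" where
  "C_ball = grad_const sphere_measure poisson_ball"

definition C_ball_dir :: "real \<Rightarrow> 'a::euclidean_space \<Rightarrow> 'a \<Rightarrow> real" where
  "C_ball_dir = grad_const_dir sphere_measure poisson_ball"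

definition C_halfspace :: "real \<Rightarrow> 'a::euclidean_space \<times> real \<Rightarrow> real" where
  "C_halfspace = grad_const lborel poisson_halfspace"

definition C_halfspace_dir :: "real \<Rightarrow> 'a::euclidean_space \<times> real \<Rightarrow> 'a \<times> real \<Rightarrow> real" where
  "C_halfspace_dir = grad_const_dir lborel poisson_halfspace"

end

theory Submission imports Defs begin

text \<open>By duality the directional constant is the \<open>L\<^sup>q\<close> norm of the derivative of the kernel. In both
  geometries the gradient of the logarithm of the kernel has constant length, so it defines a map
  \<open>\<eta>\<close> from the boundary to the unit sphere, and the kernel is a power of an affine function of \<open>\<eta> \<bullet> e\<close>,
  where \<open>e\<close> is the radial, resp. vertical, direction. By Moebius invariance, \<open>\<eta>\<close> carries the kernel measure
  to a reflection-invariant measure on the sphere, and the \<open>q\<close>-th power of the constant becomes a multiple of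
  \<open>\<integral> (A + B (z \<bullet> e))\<^sup>a \<bar>z \<bullet> l\<bar>\<^sup>q\<close> with \<open>a = (n - 1) (q - 1)\<close>. The range of \<open>q\<close> says exactly that \<open>a < 1\<close>, so the
  even part of the weight decreases in \<open>\<bar>z \<bullet> e\<bar>\<close>; comparing the integrand with its mirror image under the
  reflection that exchanges two directions then shows that the integral is minimal for \<open>l = \<plusminus>e\<close>
  and maximal for \<open>l\<close> orthogonal to \<open>e\<close>.\<close>

section \<open>Change of variables in Euclidean spaces\<close>

text \<open>The exponent a arises by splitting the q-th power of the kernel: one factor is absorbed
  as density or Jacobian, and the (q - 1)-st power of the rest is the affine function of
  \<open>\<eta> \<bullet> e\<close> to the power a. The obstacle is that a symmetry of the measure
  that moves l also moves e, and with it the weight. So the integrals for two directions are not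
  compared directly: with W the symmetrised weight and a', l' mirror images, the integral of (W (z
  \<bullet> a) - W (z \<bullet> a')) times (|z \<bullet> l'|^q - |z \<bullet> l|^q) has a
  nonnegative integrand and, by symmetry, equals twice the difference sought. Symmetrising costs
  nothing, because a product of two reflections sends both e and l to their negatives. All
  symmetries used are hyperplane reflections, so invariance is proved one reflection at a time. On
  the half-space each is lifted to a boundary reflection or to an inversion that fixes x; on the
  ball, the definition of surface measure by cones turns every integral into one over the solid
  ball, where the boundary map acts through its homogeneous extension.\<close>

text \<open>The change-of-variables theorem of the library needs a well-ordered index type, so Euclidean
  spaces are identified with \<open>real ^ 'a basis_index\<close>.\<close>

typedef (overloaded) 'a basis_index = "{..<DIM('a::euclidean_space)}"
  by (auto intro!: exI[of _ 0])

setup_lifting type_definition_basis_index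

instantiation basis_index :: (euclidean_space) wellorder
begin

lift_definition less_eq_basis_index :: "'a basis_index \<Rightarrow> 'a basis_index \<Rightarrow> bool" is "(\<le>)" .
lift_definition less_basis_index :: "'a basis_index \<Rightarrow> 'a basis_index \<Rightarrow> bool" is "(<)" .

instance
proof
  fix P :: "'a basis_index \<Rightarrow> bool" and a
  assume step: "\<And>x. (\<And>y. y < x \<Longrightarrow> P y) \<Longrightarrow> P x"
  show "P a"
    by (induction a rule: measure_induct[of Rep_basis_index]) (auto intro: step simp: less_basis_index.rep_eq)
qed (transfer; auto)+

end

instance basis_index :: (euclidean_space) finite
proof
  show "finite (UNIV :: 'a basis_index set)"
    unfolding type_definition.univ[OF type_definition_basis_index] by simp
qed

lemma card_basis_index: "CARD('a::euclidean_space basis_index) = DIM('a)"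
  unfolding type_definition.card[OF type_definition_basis_index] by simp

definition basis_at :: "'a::euclidean_space basis_index \<Rightarrow> 'a" where
  "basis_at = (SOME b. bij_betw b UNIV Basis)"

lemma bij_betw_basis_at: "bij_betw basis_at UNIV (Basis :: 'a::euclidean_space set)"
  unfolding basis_at_def
proof (rule someI_ex[of "\<lambda>b. bij_betw b UNIV (Basis :: 'a set)"])
  show "\<exists>b. bij_betw b (UNIV :: 'a basis_index set) (Basis :: 'a set)"
    by (rule finite_same_card_bij) (simp_all add: card_basis_index)
qed

definition to_cart :: "'a::euclidean_space \<Rightarrow> real ^ 'a basis_index" where
  "to_cart x = (\<chi> i. x \<bullet> basis_at i)"

definition of_cart :: "real ^ 'a basis_index \<Rightarrow> 'a::euclidean_space" where
  "of_cart v = (\<Sum>i\<in>UNIV. v $ i *\<^sub>R basis_at i)"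

lemma inner_to_cart: "to_cart x \<bullet> to_cart y = x \<bullet> y"
  by (simp add: to_cart_def inner_vec_def euclidean_inner[of x y] sum.reindex_bij_betw[OF bij_betw_basis_at, symmetric])

lemma of_cart_to_cart [simp]: "of_cart (to_cart x) = x"
  using sum.reindex_bij_betw[OF bij_betw_basis_at, of "\<lambda>b. (x \<bullet> b) *\<^sub>R b"]
  by (simp add: to_cart_def of_cart_def euclidean_representation)

lemma inner_basis_at: "basis_at i \<bullet> basis_at j = (if i = j then 1 else 0)"
proof -
  have "basis_at i \<in> Basis" "basis_at j \<in> Basis" "basis_at i = basis_at j \<longleftrightarrow> i = j"
    using bij_betw_basis_at[where 'a='a] by (auto simp: bij_betw_def inj_eq)
  then show ?thesis
    by (simp add: inner_Basis)
qed

lemma to_cart_of_cart [simp]: "to_cart (of_cart v) = v"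
  by (simp add: to_cart_def of_cart_def inner_sum_left inner_basis_at if_distrib vec_eq_iff cong: if_cong)

lemma linear_to_cart: "linear to_cart"
  by (rule linearI) (simp_all add: to_cart_def inner_add_left vec_eq_iff)

lemma linear_of_cart: "linear of_cart"
  by (rule linearI) (simp_all add: of_cart_def scaleR_add_left sum.distrib scaleR_sum_right)

lemma norm_to_cart: "norm (to_cart x) = norm x"
  by (simp add: norm_eq_sqrt_inner inner_to_cart)

lemma bounded_linear_to_cart: "bounded_linear to_cart"
  by (simp add: linear_conv_bounded_linear[symmetric] linear_to_cart)

lemma bounded_linear_of_cart: "bounded_linear of_cart"
  by (simp add: linear_conv_bounded_linear[symmetric] linear_of_cart)

lemma measurable_to_cart [measurable]: "to_cart \<in> borel_measurable borel"
  and measurable_of_cart [measurable]: "of_cart \<in> borel_measurable borel"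
  by (auto intro!: borel_measurable_continuous_onI linear_continuous_on bounded_linear_to_cart bounded_linear_of_cart)

text \<open>Lebesgue measure is determined by its values on boxes, and the coordinate map matches
  boxes of equal side lengths because \<open>basis_at\<close> enumerates the basis.\<close>

lemma lborel_distr_of_cart: "distr lborel borel of_cart = (lborel :: 'a::euclidean_space measure)"
proof (rule lborel_eqI[symmetric])
  fix l u :: 'a assume le: "\<And>b. b \<in> Basis \<Longrightarrow> l \<bullet> b \<le> u \<bullet> b"
  have le': "l \<bullet> basis_at i \<le> u \<bullet> basis_at i" for i
    using le bij_betw_basis_at by (auto simp: bij_betw_def)
  have comp: "of_cart v \<bullet> basis_at i = v $ i" for v :: "real ^ 'a basis_index" and i
    using to_cart_of_cart[of v] by (metis to_cart_def vec_lambda_beta)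
  have "of_cart -` box l u = box (to_cart l) (to_cart u)"
  proof -
    have "(\<forall>b\<in>Basis. l \<bullet> b < x \<bullet> b \<and> x \<bullet> b < u \<bullet> b) \<longleftrightarrow> (\<forall>i. l \<bullet> basis_at i < x \<bullet> basis_at i \<and> x \<bullet> basis_at i < u \<bullet> basis_at i)" for x
      using bij_betw_basis_at[where 'a='a] by (metis (no_types, lifting) UNIV_I bij_betw_def imageE imageI)
    then show ?thesis
      unfolding set_eq_iff vimage_eq mem_box(1)[of _ l u] mem_box_cart(1) by (simp add: comp to_cart_def)
  qed
  then have "emeasure (distr lborel borel of_cart) (box l u) = emeasure lborel (box (to_cart l) (to_cart u))"
    by (subst emeasure_distr) auto
  also have "\<dots> = (\<Prod>b\<in>Basis. (to_cart u - to_cart l) \<bullet> b)"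
    by (subst emeasure_lborel_box) (auto simp: Basis_vec_def cart_eq_inner_axis[symmetric] to_cart_def le')
  also have "(\<Prod>b\<in>Basis. (to_cart u - to_cart l) \<bullet> b) = (\<Prod>i\<in>UNIV. (to_cart u - to_cart l) $ i)"
  proof -
    have "bij_betw (\<lambda>i. axis i (1::real)) UNIV (Basis :: (real ^ 'a basis_index) set)"
      by (auto simp: bij_betw_def Basis_vec_def inj_on_def axis_eq_axis)
    then show ?thesis
      unfolding cart_eq_inner_axis by (rule prod.reindex_bij_betw[symmetric])
  qed
  also have "(\<Prod>i\<in>UNIV. (to_cart u - to_cart l) $ i) = (\<Prod>b\<in>Basis. (u - l) \<bullet> b)"
    using prod.reindex_bij_betw[OF bij_betw_basis_at, of "\<lambda>b. (u - l) \<bullet> b"]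
    by (simp add: to_cart_def inner_diff_left)
  finally show "emeasure (distr lborel borel of_cart) (box l u) = (\<Prod>b\<in>Basis. (u - l) \<bullet> b)" .
qed simp

text \<open>Bridge between two conventions: the integrals here are over \<open>lborel\<close>, while
  the transformation theorem speaks of the completed measure. For Borel integrands completion
  changes neither integrability nor value.\<close>

lemma set_integral_of_cart:
  fixes f :: "'a::euclidean_space \<Rightarrow> real"
  assumes [measurable]: "S \<in> sets borel" "f \<in> borel_measurable borel"
  shows "set_integrable lborel S f \<longleftrightarrow> (\<lambda>v. f (of_cart v)) absolutely_integrable_on (of_cart -` S)"
    and "(LINT x:S|lborel. f x) = (LINT v:of_cart -` S|lebesgue. f (of_cart v))"
proof -
  have [measurable]: "of_cart -` S \<in> sets borel"
    using measurable_sets[OF measurable_of_cart, of S] by simp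
  have [measurable]: "(\<lambda>v. indicator (of_cart -` S) v *\<^sub>R f (of_cart v)) \<in> borel_measurable borel"
    by measurable
  have *: "indicator (of_cart -` S) v = (indicator S (of_cart v) :: real)" for v
    by (simp add: indicator_def)
  show "set_integrable lborel S f \<longleftrightarrow> (\<lambda>v. f (of_cart v)) absolutely_integrable_on (of_cart -` S)"
    unfolding set_integrable_def
    by (subst integrable_completion, simp, subst lborel_distr_of_cart[symmetric], subst integrable_distr_eq)
       (simp_all add: *)
  show "(LINT x:S|lborel. f x) = (LINT v:of_cart -` S|lebesgue. f (of_cart v))"
    unfolding set_lebesgue_integral_def
    by (subst integral_completion, simp, subst lborel_distr_of_cart[symmetric], subst integral_distr)
       (simp_all add: *)
qed

text \<open>The map acts as b on the line of \<zeta> and as a on its orthogonal complement;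
  conjugation by an orthogonal map taking a coordinate axis to \<zeta> makes the matrix
  diagonal.\<close>

lemma abs_det_dilation:
  fixes \<zeta> :: "real ^ 'n"
  assumes "norm \<zeta> = 1"
  shows "\<bar>det (matrix (\<lambda>h. a *\<^sub>R h + ((b - a) * (\<zeta> \<bullet> h)) *\<^sub>R \<zeta>))\<bar> = \<bar>a\<bar> ^ (CARD('n) - 1) * \<bar>b\<bar>"
proof -
  define k :: 'n where "k = undefined"
  obtain Q :: "real^'n \<Rightarrow> real^'n" where Q: "orthogonal_transformation Q" "Q (axis k 1) = \<zeta>"
    using orthogonal_transformation_exists_1[of "axis k (1::real)" \<zeta>] assms norm_axis_1 by metis
  have lQ: "linear Q" using Q(1) by (rule orthogonal_transformation_linear)
  have axis_nth: "axis i (1::real) $ j = (if i = j then 1 else 0)" for i j :: 'n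
    by (simp add: axis_def)
  define R where "R = inv Q"
  have R: "orthogonal_transformation R" "Q (R x) = x" for x
    using orthogonal_transformation_inv[OF Q(1)] orthogonal_transformation_surj[OF Q(1)]
    by (simp_all add: R_def surj_f_inv_f)
  define D where "D = (\<lambda>h :: real^'n. a *\<^sub>R h + ((b - a) * (axis k 1 \<bullet> h)) *\<^sub>R axis k 1)"
  have lD: "linear D"
    unfolding D_def by (rule linearI) (auto simp: algebra_simps inner_add_right)
  have eq: "(\<lambda>h. a *\<^sub>R h + ((b - a) * (\<zeta> \<bullet> h)) *\<^sub>R \<zeta>) = Q \<circ> (D \<circ> R)"
  proof
    fix h
    have "axis k 1 \<bullet> R h = Q (axis k 1) \<bullet> Q (R h)"
      using Q(1) by (simp add: orthogonal_transformation_def)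
    then show "a *\<^sub>R h + ((b - a) * (\<zeta> \<bullet> h)) *\<^sub>R \<zeta> = (Q \<circ> (D \<circ> R)) h"
      by (simp add: D_def linear_add[OF lQ] linear_scale[OF lQ] Q(2) R(2))
  qed
  have lR: "linear R" using R(1) by (rule orthogonal_transformation_linear)
  have "matrix (Q \<circ> (D \<circ> R)) = matrix Q ** (matrix D ** matrix R)"
    using lQ lD lR by (simp add: matrix_compose linear_compose)
  then have "\<bar>det (matrix (Q \<circ> (D \<circ> R)))\<bar> = \<bar>det (matrix D)\<bar>"
    using Q(1) R(1) by (simp add: det_mul abs_mult)
  also have "det (matrix D) = (\<Prod>i\<in>UNIV. matrix D $ i $ i)"
    by (rule det_diagonal) (simp add: matrix_def D_def axis_nth inner_axis_axis)
  also have "\<dots> = (\<Prod>i\<in>UNIV. if i = k then b else a)"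
    by (rule prod.cong) (simp_all add: matrix_def D_def axis_nth inner_axis_axis)
  also have "\<dots> = a ^ (CARD('n) - 1) * b"
    by (simp add: prod.If_cases Compl_eq_Diff_UNIV card_Diff_singleton)
  finally have "\<bar>det (matrix (Q \<circ> (D \<circ> R)))\<bar> = \<bar>a\<bar> ^ (CARD('n) - 1) * \<bar>b\<bar>"
    by (simp only: abs_mult power_abs)
  then show ?thesis
    by (simp only: eq)
qed

text \<open>This shape of the derivative, a stretch by b along z and by a across it followed by an
  orthogonal map, covers both uses: conformal maps, where a = b, and the cone map of the ball, whose
  radial and tangential factors differ.\<close>

lemma change_of_variables_dilation:
  fixes g :: "'a::euclidean_space \<Rightarrow> 'a" and f :: "'a \<Rightarrow> real"
  assumes S [measurable]: "S \<in> sets borel" and T [measurable]: "T \<in> sets borel" and gS: "g ` S = T"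
    and inj: "inj_on g S"
    and f [measurable]: "f \<in> borel_measurable borel" and g [measurable]: "g \<in> borel_measurable borel"
    and a [measurable]: "a \<in> borel_measurable borel" and b [measurable]: "b \<in> borel_measurable borel"
    and z: "\<And>x. x \<in> S \<Longrightarrow> norm (z x) = 1"
    and Q: "\<And>x. x \<in> S \<Longrightarrow> orthogonal_transformation (Q x)"
    and deriv: "\<And>x. x \<in> S \<Longrightarrow>
      (g has_derivative (\<lambda>h. Q x (a x *\<^sub>R h + ((b x - a x) * (z x \<bullet> h)) *\<^sub>R z x))) (at x)"
  shows "set_integrable lborel S (\<lambda>x. \<bar>a x\<bar> ^ (DIM('a) - 1) * \<bar>b x\<bar> * f (g x)) \<longleftrightarrow> set_integrable lborel T f"
    and "(LINT x:S|lborel. \<bar>a x\<bar> ^ (DIM('a) - 1) * \<bar>b x\<bar> * f (g x)) = (LINT x:T|lborel. f x)"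
proof -
  define G where "G = to_cart \<circ> g \<circ> of_cart"
  \<comment> \<open>The transformation theorem takes vector-valued integrands, so f is wrapped as a
    map into \<open>real ^ 1\<close>.\<close>
  define F where "F = (\<lambda>v. f (of_cart v) *\<^sub>R axis (1::1) (1::real))"
  define S' where "S' = (of_cart -` S :: (real ^ 'a basis_index) set)"
  define D where "D = (\<lambda>x h. Q x (a x *\<^sub>R h + ((b x - a x) * (z x \<bullet> h)) *\<^sub>R z x))"
  define D' where "D' = (\<lambda>v. to_cart \<circ> D (of_cart v) \<circ> of_cart)"
  define J where "J = (\<lambda>x. \<bar>a x\<bar> ^ (DIM('a) - 1) * \<bar>b x\<bar>)"
  have [measurable]: "S' \<in> sets borel"
    unfolding S'_def using measurable_sets[OF measurable_of_cart S] by simp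
  have GS: "G ` S' = of_cart -` T"
  proof -
    have "G ` S' = to_cart ` g ` S"
    proof -
      have "of_cart -` S = to_cart ` S"
        by (auto simp: image_iff) (metis to_cart_of_cart)
      then show ?thesis
        unfolding G_def S'_def by (simp add: image_image)
    qed
    also have "\<dots> = of_cart -` T"
      unfolding gS by (auto simp: image_iff) (metis to_cart_of_cart)
    finally show ?thesis .
  qed
  have dG: "(G has_derivative D' v) (at v within S')" if "v \<in> S'" for v
    unfolding G_def D'_def
    using that deriv[of "of_cart v"]
    by (intro diff_chain_within has_derivative_at_withinI[OF bounded_linear_imp_has_derivative]
        bounded_linear_to_cart bounded_linear_of_cart)
      (auto simp: S'_def D_def intro: has_derivative_at_withinI)
  have injG: "inj_on G S'"
  proof (rule inj_onI)
    fix v w assume vw: "v \<in> S'" "w \<in> S'" "G v = G w"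
    have "of_cart (G v) = of_cart (G w)"
      using vw(3) by simp
    then have "g (of_cart v) = g (of_cart w)"
      by (simp add: G_def)
    then have "of_cart v = of_cart w"
      using inj vw by (auto simp: inj_on_def S'_def)
    then have "to_cart (of_cart v) = to_cart (of_cart w)"
      by simp
    then show "v = w"
      by simp
  qed
  have det: "\<bar>det (matrix (D' v))\<bar> = J (of_cart v)" if "v \<in> S'" for v
  proof -
    let ?x = "of_cart v"
    let ?E = "\<lambda>h. a ?x *\<^sub>R h + ((b ?x - a ?x) * (to_cart (z ?x) \<bullet> h)) *\<^sub>R to_cart (z ?x)"
    let ?Q = "to_cart \<circ> Q ?x \<circ> of_cart"
    have x: "?x \<in> S" using that by (simp add: S'_def)
    have "D' v h = ?Q (?E h)" for h
    proof -
      have "z ?x \<bullet> of_cart h = to_cart (z ?x) \<bullet> h"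
        by (metis inner_to_cart to_cart_of_cart)
      then show ?thesis
        by (simp add: D'_def D_def linear_add[OF linear_of_cart] linear_scale[OF linear_of_cart])
    qed
    then have "D' v = ?Q \<circ> ?E" by auto
    moreover have "orthogonal_transformation ?Q"
      unfolding orthogonal_transformation_def
    proof (intro conjI allI)
      show "linear ?Q"
        using Q[OF x] by (intro linear_compose linear_to_cart linear_of_cart orthogonal_transformation_linear)
      fix v w :: "real ^ 'a basis_index"
      have "?Q v \<bullet> ?Q w = of_cart v \<bullet> of_cart w"
        using Q[OF x] by (simp add: inner_to_cart orthogonal_transformation_def)
      then show "?Q v \<bullet> ?Q w = v \<bullet> w"
        by (simp add: inner_to_cart[symmetric, where 'a='a])
    qed
    moreover have "linear ?E"
      by (rule linearI) (simp_all add: algebra_simps inner_add_right)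
    moreover have "norm (to_cart (z ?x)) = 1"
      using z[OF x] by (simp add: norm_to_cart)
    ultimately show ?thesis
      by (simp add: matrix_compose orthogonal_transformation_linear det_mul abs_mult abs_det_dilation
          card_basis_index J_def)
  qed
  \<comment> \<open>One equivalence carries both claims: c is free, so choosing it as the actual
    value of the left integral transfers the value along with integrability.\<close>
  have cov: "(\<lambda>v. \<bar>det (matrix (D' v))\<bar> *\<^sub>R F (G v)) absolutely_integrable_on S' \<and>
      integral S' (\<lambda>v. \<bar>det (matrix (D' v))\<bar> *\<^sub>R F (G v)) = c
     \<longleftrightarrow> F absolutely_integrable_on (G ` S') \<and> integral (G ` S') F = c" for c
    by (rule has_absolute_integral_change_of_variables[OF _ dG injG]) auto
  let ?h = "\<lambda>v. J (of_cart v) * f (g (of_cart v))"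
  let ?e = "axis (1::1) (1::real)"
  have eq: "\<bar>det (matrix (D' v))\<bar> *\<^sub>R F (G v) = ?h v *\<^sub>R ?e" if "v \<in> S'" for v
    using det[OF that] by (simp add: F_def G_def)
  have abs_iff: "(\<lambda>v. k v *\<^sub>R ?e) absolutely_integrable_on U \<longleftrightarrow> k absolutely_integrable_on U"
    for k :: "real ^ 'a basis_index \<Rightarrow> real" and U
  proof
    assume "(\<lambda>v. k v *\<^sub>R ?e) absolutely_integrable_on U"
    then have "integrable lebesgue (\<lambda>v. (indicator U v *\<^sub>R k v *\<^sub>R ?e) \<bullet> ?e)"
      unfolding set_integrable_def by (rule integrable_inner_left)
    then show "k absolutely_integrable_on U"
      by (simp add: set_integrable_def inner_axis)
  qed (rule set_integrable_scaleR_left)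
  have int_eq: "integral U (\<lambda>v. k v *\<^sub>R ?e) = (LINT v:U|lebesgue. k v) *\<^sub>R ?e"
    if "k absolutely_integrable_on U" for k :: "real ^ 'a basis_index \<Rightarrow> real" and U
    using that set_lebesgue_integral_eq_integral(2)[OF that] set_lebesgue_integral_eq_integral(1)[OF that]
    by (simp add: integral_unique has_integral_scaleR_left integrable_integral)
  have A1: "(\<lambda>v. \<bar>det (matrix (D' v))\<bar> *\<^sub>R F (G v)) absolutely_integrable_on S' \<longleftrightarrow> ?h absolutely_integrable_on S'"
    unfolding abs_iff[symmetric] by (rule set_integrable_cong) (auto simp: eq)
  have A2: "integral S' (\<lambda>v. \<bar>det (matrix (D' v))\<bar> *\<^sub>R F (G v)) = integral S' (\<lambda>v. ?h v *\<^sub>R ?e)"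
    by (rule integral_cong) (simp add: eq)
  have A3: "F absolutely_integrable_on (G ` S') \<longleftrightarrow> (\<lambda>v. f (of_cart v)) absolutely_integrable_on (of_cart -` T)"
    unfolding abs_iff[symmetric] GS F_def ..
  have B1: "set_integrable lborel S (\<lambda>x. J x * f (g x)) \<longleftrightarrow> ?h absolutely_integrable_on S'"
    "(LINT x:S|lborel. J x * f (g x)) = (LINT v:S'|lebesgue. ?h v)"
    unfolding S'_def by (rule set_integral_of_cart; simp add: J_def)+
  have B2: "set_integrable lborel T f \<longleftrightarrow> (\<lambda>v. f (of_cart v)) absolutely_integrable_on (of_cart -` T)"
    "(LINT x:T|lborel. f x) = (LINT v:of_cart -` T|lebesgue. f (of_cart v))"
    by (rule set_integral_of_cart; simp)+
  have iff: "?h absolutely_integrable_on S' \<longleftrightarrow> (\<lambda>v. f (of_cart v)) absolutely_integrable_on (of_cart -` T)"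
    using cov A1 A3 by blast
  then show "set_integrable lborel S (\<lambda>x. \<bar>a x\<bar> ^ (DIM('a) - 1) * \<bar>b x\<bar> * f (g x)) \<longleftrightarrow> set_integrable lborel T f"
    using B1(1) B2(1) by (simp add: J_def)
  show "(LINT x:S|lborel. \<bar>a x\<bar> ^ (DIM('a) - 1) * \<bar>b x\<bar> * f (g x)) = (LINT x:T|lborel. f x)"
  proof (cases "?h absolutely_integrable_on S'")
    case True
    then have T': "(\<lambda>v. f (of_cart v)) absolutely_integrable_on (of_cart -` T)"
      using iff by blast
    have "integral S' (\<lambda>v. ?h v *\<^sub>R ?e) = integral (of_cart -` T) F"
      using cov[of "integral S' (\<lambda>v. ?h v *\<^sub>R ?e)"] A1 A2 True GS by simp
    then have "(LINT v:S'|lebesgue. ?h v) *\<^sub>R ?e = (LINT v:of_cart -` T|lebesgue. f (of_cart v)) *\<^sub>R ?e"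
      using int_eq[OF True] int_eq[OF T'] by (simp add: F_def)
    then show ?thesis
      using B1(2) B2(2) by (simp add: J_def axis_eq_0_iff)
  next
    \<comment> \<open>Neither side is integrable, so both integrals take the default value
      0.\<close>
    case False
    then have "\<not> set_integrable lborel S (\<lambda>x. J x * f (g x))" "\<not> set_integrable lborel T f"
      using iff B1(1) B2(1) by blast+
    then show ?thesis
      unfolding set_integrable_def set_lebesgue_integral_def J_def
      by (rule trans[OF not_integrable_integral_eq not_integrable_integral_eq[symmetric]])
  qed
qed

section \<open>Differentiation under the integral and duality\<close>

text \<open>\<open>gradient\<close> is a definite description, so uniqueness has to be shown too:
  two candidates are tested on their difference.\<close>

lemma gradient_eqI:
  assumes "GDERIV f x :> D" shows "gradient f x = D"
  unfolding gradient_def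
proof (rule the_equality)
  show "GDERIV f x :> D" by (rule assms)
  fix D' assume "GDERIV f x :> D'"
  then have "(\<lambda>h. h \<bullet> D') = (\<lambda>h. h \<bullet> D)"
    using assms unfolding gderiv_def by (rule has_derivative_unique)
  then have "(D' - D) \<bullet> D' = (D' - D) \<bullet> D"
    by (rule fun_cong)
  then have "(D' - D) \<bullet> (D' - D) = 0"
    by (simp add: inner_diff_right)
  then show "D' = D" by simp
qed

text \<open>A bound B on the gradients, uniform over a ball around x, makes K Lipschitz there by the
  mean value inequality. The remainder quotients are then dominated by 2 B, and dominated
  convergence applies.\<close>

lemma GDERIV_integral:
  fixes K :: "'a::euclidean_space \<Rightarrow> 'b \<Rightarrow> real" and g :: "'a \<Rightarrow> 'b \<Rightarrow> 'a"
  assumes r: "0 < r"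
    and deriv: "\<And>z y. z \<in> ball x r \<Longrightarrow> y \<in> space M \<Longrightarrow> GDERIV (\<lambda>z. K z y) z :> g z y"
    and bound: "\<And>z y. z \<in> ball x r \<Longrightarrow> y \<in> space M \<Longrightarrow> norm (g z y) \<le> B y"
    and K_meas: "\<And>z. z \<in> ball x r \<Longrightarrow> K z \<in> borel_measurable M"
    and g_meas [measurable]: "g x \<in> borel_measurable M"
    and \<phi> [measurable]: "\<phi> \<in> borel_measurable M"
    and intB: "integrable M (\<lambda>y. B y * \<phi> y)" and intK: "integrable M (\<lambda>y. K x y * \<phi> y)"
  shows "GDERIV (\<lambda>z. \<integral>y. K z y * \<phi> y \<partial>M) x :> (\<integral>y. \<phi> y *\<^sub>R g x y \<partial>M)"
proof -
  have x: "x \<in> ball x r" using r by simp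
  have B0: "0 \<le> B y" if "y \<in> space M" for y
    using bound[OF x that] norm_ge_zero order_trans by blast
  have lip: "\<bar>K z y - K x y\<bar> \<le> B y * norm (z - x)" if "z \<in> ball x r" "y \<in> space M" for z y
  proof -
    have "norm (K z y - K x y) \<le> B y * norm (z - x)"
    proof (rule differentiable_bound[OF convex_ball])
      fix w assume w: "w \<in> ball x r"
      show "((\<lambda>z. K z y) has_derivative (\<lambda>h. h \<bullet> g w y)) (at w within ball x r)"
        using deriv[OF w that(2)] unfolding gderiv_def by (rule has_derivative_at_withinI)
      have "norm (h \<bullet> g w y) \<le> B y * norm h" for h
        using Cauchy_Schwarz_ineq2[of h "g w y"] mult_right_mono[OF bound[OF w that(2)], of "norm h"]
        by (simp add: mult.commute)
      then show "onorm (\<lambda>h. h \<bullet> g w y) \<le> B y"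
        by (intro onorm_bound B0 that) 
    qed (use that x in auto)
    then show ?thesis by simp
  qed
  have intg: "integrable M (\<lambda>y. \<phi> y *\<^sub>R g x y)"
  proof (rule Bochner_Integration.integrable_bound[OF intB])
    show "AE y in M. norm (\<phi> y *\<^sub>R g x y) \<le> norm (B y * \<phi> y)"
      using bound[OF x] B0 by (auto simp: abs_mult mult.commute[of "\<bar>\<phi> _\<bar>"] intro!: mult_right_mono AE_I2)
  qed simp
  \<comment> \<open>Integrability is assumed at x; the Lipschitz bound carries it to nearby
    points.\<close>
  have intK': "integrable M (\<lambda>y. K z y * \<phi> y)" if z: "z \<in> ball x r" for z
  proof -
    have "integrable M (\<lambda>y. (K z y - K x y) * \<phi> y)"
    proof (rule Bochner_Integration.integrable_bound[OF integrable_mult_right[OF intB, of "norm (z - x)"]])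
      show "(\<lambda>y. (K z y - K x y) * \<phi> y) \<in> borel_measurable M"
        using K_meas[OF z] K_meas[OF x] by simp
      show "AE y in M. norm ((K z y - K x y) * \<phi> y) \<le> norm (norm (z - x) * (B y * \<phi> y))"
      proof (rule AE_I2)
        fix y assume "y \<in> space M"
        then show "norm ((K z y - K x y) * \<phi> y) \<le> norm (norm (z - x) * (B y * \<phi> y))"
          using mult_right_mono[OF lip[OF z], of y "\<bar>\<phi> y\<bar>"] B0[of y] by (simp add: abs_mult ac_simps)
      qed
    qed
    from Bochner_Integration.integrable_add[OF this intK] show ?thesis
      by (simp add: algebra_simps)
  qed
  define G where "G = (\<integral>y. \<phi> y *\<^sub>R g x y \<partial>M)"
  define u where "u = (\<lambda>z. \<integral>y. K z y * \<phi> y \<partial>M)"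
  define R where "R = (\<lambda>z y. (K z y - K x y - (z - x) \<bullet> g x y) / norm (z - x))"
  have R_eq: "norm (u z - u x - (z - x) \<bullet> G) / norm (z - x) = \<bar>\<integral>y. R z y * \<phi> y \<partial>M\<bar>" if z: "z \<in> ball x r" for z
  proof -
    have "(\<integral>y. R z y * \<phi> y \<partial>M) = (\<integral>y. (K z y * \<phi> y - K x y * \<phi> y - (z - x) \<bullet> (\<phi> y *\<^sub>R g x y)) / norm (z - x) \<partial>M)"
      unfolding R_def by (rule Bochner_Integration.integral_cong) (auto simp: field_simps)
    also have "\<dots> = (u z - u x - (z - x) \<bullet> G) / norm (z - x)"
      unfolding integral_divide_zero u_def G_def
      using intK'[OF z] intK intg by (simp only: Bochner_Integration.integral_diff Bochner_Integration.integrable_diff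
        integrable_inner_right integral_inner_right simp_thms)
    finally show ?thesis by (simp add: abs_divide)
  qed
  have R_bound: "\<bar>R z y\<bar> \<le> 2 * B y" if z: "z \<in> ball x r" "z \<noteq> x" and y: "y \<in> space M" for z y
  proof -
    have "\<bar>(z - x) \<bullet> g x y\<bar> \<le> B y * norm (z - x)"
      using Cauchy_Schwarz_ineq2[of "z - x" "g x y"] mult_right_mono[OF bound[OF x y], of "norm (z - x)"]
      by (simp add: mult.commute)
    then have "\<bar>K z y - K x y - (z - x) \<bullet> g x y\<bar> \<le> 2 * B y * norm (z - x)"
      using lip[OF z(1) y] by linarith
    then show ?thesis
      using z(2) by (simp add: R_def abs_divide divide_le_eq)
  qed
  have R_lim: "((\<lambda>z. R z y) \<longlongrightarrow> 0) (at x)" if y: "y \<in> space M" for y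
  proof -
    have "((\<lambda>z. norm (K z y - K x y - (z - x) \<bullet> g x y) / norm (z - x)) \<longlongrightarrow> 0) (at x)"
      using deriv[OF x y] by (simp add: gderiv_def has_derivative_iff_norm)
    then show ?thesis
      unfolding R_def by (subst tendsto_rabs_zero_iff[symmetric]) (simp add: abs_divide)
  qed
  have "((\<lambda>z. norm (u z - u x - (z - x) \<bullet> G) / norm (z - x)) \<longlongrightarrow> 0) (at x)"
    \<comment> \<open>Dominated convergence concerns sequences, so the limit is tested along
      sequences, shifted by N to lie inside the ball.\<close>
    unfolding tendsto_at_iff_sequentially o_def
  proof (intro allI impI)
    fix X assume X: "\<forall>i. X i \<in> UNIV - {x}" "X \<longlonglongrightarrow> x"
    obtain N where N: "\<And>n. n \<ge> N \<Longrightarrow> X n \<in> ball x r"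
      using topological_tendstoD[OF X(2) open_ball x] by (auto simp: eventually_sequentially)
    define Y where "Y i = X (i + N)" for i
    have Y: "Y i \<in> ball x r" "Y i \<noteq> x" for i
      using N[of "i + N"] X(1) by (auto simp: Y_def)
    have Y_lim: "Y \<longlonglongrightarrow> x"
      unfolding Y_def using LIMSEQ_ignore_initial_segment[OF X(2)] .
    have "(\<lambda>i. \<integral>y. R (Y i) y * \<phi> y \<partial>M) \<longlonglongrightarrow> (\<integral>y. 0 \<partial>M)"
    proof (rule integral_dominated_convergence[where w = "\<lambda>y. 2 * \<bar>B y * \<phi> y\<bar>"])
      show "(\<lambda>y. R (Y i) y * \<phi> y) \<in> borel_measurable M" for i
        unfolding R_def using K_meas[OF Y(1)[of i]] K_meas[OF x] by simp
      show "integrable M (\<lambda>y. 2 * \<bar>B y * \<phi> y\<bar>)"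
        using intB by simp
      show "AE y in M. (\<lambda>i. R (Y i) y * \<phi> y) \<longlonglongrightarrow> 0"
      proof (rule AE_I2)
        fix y assume "y \<in> space M"
        then have "(\<lambda>i. R (Y i) y) \<longlonglongrightarrow> 0"
          using R_lim[of y] Y Y_lim unfolding tendsto_at_iff_sequentially o_def by auto
        then show "(\<lambda>i. R (Y i) y * \<phi> y) \<longlonglongrightarrow> 0"
          by (rule tendsto_mult_left_zero)
      qed
      show "AE y in M. norm (R (Y i) y * \<phi> y) \<le> 2 * \<bar>B y * \<phi> y\<bar>" for i
      proof (rule AE_I2)
        fix y assume y: "y \<in> space M"
        show "norm (R (Y i) y * \<phi> y) \<le> 2 * \<bar>B y * \<phi> y\<bar>"
          using mult_right_mono[OF R_bound[OF Y(1) Y(2) y], of "\<bar>\<phi> y\<bar>" i] B0[OF y] by (simp add: abs_mult)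
      qed
    qed simp
    then have "(\<lambda>i. \<bar>\<integral>y. R (Y i) y * \<phi> y \<partial>M\<bar>) \<longlonglongrightarrow> 0"
      by (simp add: tendsto_rabs_zero)
    then have "(\<lambda>i. norm (u (Y i) - u x - (Y i - x) \<bullet> G) / norm (Y i - x)) \<longlonglongrightarrow> 0"
      by (simp only: R_eq[OF Y(1)])
    then show "(\<lambda>i. norm (u (X i) - u x - (X i - x) \<bullet> G) / norm (X i - x)) \<longlonglongrightarrow> 0"
      unfolding Y_def by (rule LIMSEQ_offset)
  qed
  then show ?thesis
    unfolding gderiv_def has_derivative_iff_norm u_def G_def by (simp add: bounded_linear_inner_left)
qed

section \<open>Lebesgue spaces: Hoelder's inequality, its sharpness, and best constants\<close>

lemma conj_exp_gt_1: "1 < q \<Longrightarrow> 1 < conj_exp q"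
  by (simp add: conj_exp_def field_simps)

lemma Lp_spaceI: "f \<in> borel_measurable M \<Longrightarrow> integrable M (\<lambda>y. \<bar>f y\<bar> powr p) \<Longrightarrow> f \<in> Lp_space M p"
  by (simp add: Lp_space_def)

lemma Lp_norm_nonneg: "0 \<le> Lp_norm M p f"
  by (simp add: Lp_norm_def)

lemma Lp_mult_integrable:
  assumes q: "1 < q" and f: "f \<in> Lp_space M (conj_exp q)" and h: "h \<in> Lp_space M q"
  shows "integrable M (\<lambda>y. f y * h y)"
proof (rule Bochner_Integration.integrable_bound)
  show "integrable M (\<lambda>y. \<bar>f y\<bar> powr conj_exp q / conj_exp q + \<bar>h y\<bar> powr q / q)"
    using f h by (simp add: Lp_space_def)
  show "(\<lambda>y. f y * h y) \<in> borel_measurable M"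
    using f h by (auto simp: Lp_space_def)
  show "AE y in M. norm (f y * h y) \<le> norm (\<bar>f y\<bar> powr conj_exp q / conj_exp q + \<bar>h y\<bar> powr q / q)"
  proof (rule AE_I2)
    fix y
    have "\<bar>f y\<bar> * \<bar>h y\<bar> \<le> \<bar>f y\<bar> powr conj_exp q / conj_exp q + \<bar>h y\<bar> powr q / q"
      using conj_exp_gt_1[OF q] q conj_exp_conjugate[OF q] by (intro Youngs_inequality) auto
    then show "norm (f y * h y) \<le> norm (\<bar>f y\<bar> powr conj_exp q / conj_exp q + \<bar>h y\<bar> powr q / q)"
      by (simp add: abs_mult)
  qed
qed

lemma Lp_norm_0_imp_AE_0:
  assumes f: "f \<in> Lp_space M p" and 0: "Lp_norm M p f = 0"
  shows "AE y in M. f y = 0"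
proof -
  have "(\<integral>y. \<bar>f y\<bar> powr p \<partial>M) = 0"
    using 0 by (simp add: Lp_norm_def)
  then have "AE y in M. \<bar>f y\<bar> powr p = 0"
    using f by (subst (asm) integral_nonneg_eq_0_iff_AE) (auto simp: Lp_space_def)
  then show ?thesis by simp
qed

lemma Lp_norm_powr: "p \<noteq> 0 \<Longrightarrow> Lp_norm M p f powr p = (\<integral>y. \<bar>f y\<bar> powr p \<partial>M)"
  by (simp add: Lp_norm_def powr_powr integral_nonneg_AE)

text \<open>Young's inequality is integrated after both functions are scaled to norm 1; vanishing
  norms, which cannot be scaled, are split off first.\<close>

lemma Holder_inequality:
  assumes q: "1 < q" and f: "f \<in> Lp_space M (conj_exp q)" and h: "h \<in> Lp_space M q"
  shows "\<bar>\<integral>y. f y * h y \<partial>M\<bar> \<le> Lp_norm M q h * Lp_norm M (conj_exp q) f"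
proof -
  let ?p = "conj_exp q"
  let ?a = "Lp_norm M ?p f" and ?b = "Lp_norm M q h"
  have p: "1 < ?p" by (rule conj_exp_gt_1[OF q])
  have [measurable]: "f \<in> borel_measurable M" "h \<in> borel_measurable M"
    using f h by (simp_all add: Lp_space_def)
  show ?thesis
  proof (cases "?a = 0 \<or> ?b = 0")
    case True
    then have "AE y in M. f y * h y = 0"
      using Lp_norm_0_imp_AE_0[OF f] Lp_norm_0_imp_AE_0[OF h] by auto
    then have "(\<integral>y. f y * h y \<partial>M) = 0"
      by (rule integral_eq_zero_AE)
    then show ?thesis
      by (simp add: Lp_norm_nonneg)
  next
    case False
    then have pos: "0 < ?a" "0 < ?b"
      using Lp_norm_nonneg[of M ?p f] Lp_norm_nonneg[of M q h] by auto
    have le: "\<bar>f y * h y\<bar> / (?a * ?b) \<le> \<bar>f y\<bar> powr ?p / ?a powr ?p / ?p + \<bar>h y\<bar> powr q / ?b powr q / q" for y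
      using Youngs_inequality[of ?p q "\<bar>f y\<bar> / ?a" "\<bar>h y\<bar> / ?b"] p q conj_exp_conjugate[OF q] pos
      by (simp add: powr_divide abs_mult)
    have int: "integrable M (\<lambda>y. f y * h y)"
      by (rule Lp_mult_integrable[OF q f h])
    have "(\<integral>y. \<bar>f y * h y\<bar> / (?a * ?b) \<partial>M) \<le>
        (\<integral>y. \<bar>f y\<bar> powr ?p / ?a powr ?p / ?p + \<bar>h y\<bar> powr q / ?b powr q / q \<partial>M)"
      using f h int le by (intro integral_mono) (simp_all add: Lp_space_def)
    also have "\<dots> = (\<integral>y. \<bar>f y\<bar> powr ?p \<partial>M) / ?a powr ?p / ?p + (\<integral>y. \<bar>h y\<bar> powr q \<partial>M) / ?b powr q / q"
      using f h by (simp add: Lp_space_def)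
    also have "\<dots> = 1 / ?p + 1 / q"
    proof -
      have "?a powr ?p \<noteq> 0" "?b powr q \<noteq> 0" using pos by simp_all
      moreover have "?a powr ?p = (\<integral>y. \<bar>f y\<bar> powr ?p \<partial>M)" "?b powr q = (\<integral>y. \<bar>h y\<bar> powr q \<partial>M)"
        using p q by (simp_all add: Lp_norm_powr)
      ultimately show ?thesis by simp
    qed
    finally have "(\<integral>y. \<bar>f y * h y\<bar> \<partial>M) \<le> ?a * ?b"
      using pos conj_exp_conjugate[OF q] by (simp add: divide_le_eq)
    then show ?thesis
      using integral_norm_bound[of M "\<lambda>y. f y * h y"] unfolding real_norm_def mult.commute[of ?b]
      by (rule order_trans[rotated])
  qed
qed

text \<open>Sharpness of Hoelder's inequality, tested on the function that gives equality. The set A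
  serves the case where h vanishes almost everywhere: a test function of positive norm must exist
  for C to be forced nonnegative.\<close>

lemma Lp_norm_le_dual_bound:
  assumes q: "1 < q" and h: "h \<in> Lp_space M q" and A: "A \<in> sets M" "0 < measure M A"
    and C: "\<And>\<phi>. \<phi> \<in> Lp_space M (conj_exp q) \<Longrightarrow> \<bar>\<integral>y. \<phi> y * h y \<partial>M\<bar> \<le> C * Lp_norm M (conj_exp q) \<phi>"
  shows "Lp_norm M q h \<le> C"
proof -
  let ?p = "conj_exp q"
  have p: "1 < ?p" by (rule conj_exp_gt_1[OF q])
  have [measurable]: "h \<in> borel_measurable M" and inth: "integrable M (\<lambda>y. \<bar>h y\<bar> powr q)"
    using h by (simp_all add: Lp_space_def)
  define b where "b = (\<integral>y. \<bar>h y\<bar> powr q \<partial>M)"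
  have b0: "0 \<le> b" unfolding b_def by simp
  show ?thesis
  proof (cases "b = 0")
    case True
    \<comment> \<open>\<open>measure\<close> is 0 on sets of infinite measure, so a positive value
      means finite measure.\<close>
    have emA: "emeasure M A < \<infinity>"
      using A(2) by (metis infinity_ennreal_def less_top measure_eq_emeasure_eq_ennreal measure_zero_top order_less_irrefl)
    have ind: "(\<lambda>y. \<bar>indicator A y :: real\<bar> powr ?p) = indicator A"
      using p by (auto simp: indicator_def fun_eq_iff)
    have int_ind: "integrable M (indicator A :: _ \<Rightarrow> real)"
      using A(1) emA by simp
    have "indicator A \<in> Lp_space M ?p"
      using A(1) int_ind by (intro Lp_spaceI) (simp_all only: ind borel_measurable_indicator)
    moreover have "0 < Lp_norm M ?p (indicator A)"
    proof -
      have "(\<integral>y. indicator A y \<partial>M) = measure M A"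
        using A(1) by (simp add: sets.Int_space_eq2)
      then show ?thesis using A(2) by (simp only: Lp_norm_def ind powr_gt_zero)
    qed
    ultimately have "0 \<le> C"
      using C by (metis abs_ge_zero order_trans zero_le_mult_iff linorder_not_less)
    then show ?thesis using True by (simp add: Lp_norm_def b_def)
  next
    case False
    then have b: "0 < b" using b0 by simp
    \<comment> \<open>The equality case of Hoelder's inequality: since (q - 1) p = q, both
      |\<phi>|^p and \<phi> h equal |h|^q.\<close>
    define \<phi> where "\<phi> = (\<lambda>y. sgn (h y) * \<bar>h y\<bar> powr (q - 1))"
    have eq1: "\<bar>\<phi> y\<bar> powr ?p = \<bar>h y\<bar> powr q" for y
    proof -
      have "(q - 1) * ?p = q" using q by (simp add: conj_exp_def)
      then show ?thesis by (simp add: \<phi>_def abs_mult powr_powr abs_sgn_eq powr_mult)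
    qed
    have eq2: "\<phi> y * h y = \<bar>h y\<bar> powr q" for y
    proof (cases "h y = 0")
      case False
      have "sgn (h y) * h y = \<bar>h y\<bar>"
        by (simp add: abs_if sgn_if)
      then have "\<phi> y * h y = \<bar>h y\<bar> powr (q - 1) * \<bar>h y\<bar> powr 1"
        by (simp add: \<phi>_def mult.assoc mult.left_commute[of _ "\<bar>h y\<bar> powr (q - 1)"])
      also have "\<dots> = \<bar>h y\<bar> powr q" by (subst powr_add[symmetric]) simp
      finally show ?thesis .
    qed simp
    have "\<phi> \<in> borel_measurable M"
      unfolding \<phi>_def by measurable
    then have "\<phi> \<in> Lp_space M ?p"
      using inth by (intro Lp_spaceI) (simp_all add: eq1)
    then have "b \<le> C * b powr (1 / ?p)"
      using C[of \<phi>] b0 by (auto simp: eq2 Lp_norm_def eq1 b_def)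
    then have "b powr (1 / q) * b powr (1 / ?p) \<le> C * b powr (1 / ?p)"
      using b conj_exp_conjugate[OF q] by (simp add: powr_add[symmetric] add.commute)
    then show ?thesis
      using b by (simp add: Lp_norm_def b_def)
  qed
qed

text \<open>Duality makes each directional constant an L^q norm. The length of a gradient is its
  component along itself, hence is controlled by the largest directional constant, the one at t;
  testing with t shows that nothing smaller works.\<close>

lemma
  fixes H :: "'b \<Rightarrow> 'a::euclidean_space"
  assumes q: "1 < q"
    and grad: "\<And>\<phi>. \<phi> \<in> Lp_space M (conj_exp q) \<Longrightarrow> gradient (P \<phi>) x = (\<integral>y. \<phi> y *\<^sub>R H y \<partial>M)"
    and H [measurable]: "H \<in> borel_measurable M" and intH: "integrable M (\<lambda>y. norm (H y) powr q)"
    and A: "A \<in> sets M" "0 < measure M A"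
  shows grad_const_dir_eq: "grad_const_dir M P q x l = Lp_norm M q (\<lambda>y. H y \<bullet> l)"
    and grad_const_eq: "norm t = 1 \<Longrightarrow>
      (\<And>l. norm l = 1 \<Longrightarrow> Lp_norm M q (\<lambda>y. H y \<bullet> l) \<le> Lp_norm M q (\<lambda>y. H y \<bullet> t)) \<Longrightarrow>
      grad_const M P q x = Lp_norm M q (\<lambda>y. H y \<bullet> t)"
proof -
  let ?p = "conj_exp q"
  have normH: "(\<lambda>y. norm (H y)) \<in> Lp_space M q"
    using intH by (intro Lp_spaceI) simp_all
  have Hl: "(\<lambda>y. H y \<bullet> l) \<in> Lp_space M q" for l
  proof (rule Lp_spaceI)
    have "integrable M (\<lambda>y. norm l powr q * norm (H y) powr q)"
      using intH by simp
    then show "integrable M (\<lambda>y. \<bar>H y \<bullet> l\<bar> powr q)"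
    proof (rule Bochner_Integration.integrable_bound)
      have "\<bar>H y \<bullet> l\<bar> powr q \<le> (norm l * norm (H y)) powr q" for y
        using Cauchy_Schwarz_ineq2[of "H y" l] q by (intro powr_mono2) (auto simp: mult.commute)
      then show "AE y in M. norm (\<bar>H y \<bullet> l\<bar> powr q) \<le> norm (norm l powr q * norm (H y) powr q)"
        by (simp add: powr_mult)
    qed simp
  qed simp
  have grad_l: "gradient (P \<phi>) x \<bullet> l = (\<integral>y. \<phi> y * (H y \<bullet> l) \<partial>M)" if \<phi>: "\<phi> \<in> Lp_space M ?p" for \<phi> l
  proof -
    have [measurable]: "\<phi> \<in> borel_measurable M" using \<phi> by (simp add: Lp_space_def)
    have "integrable M (\<lambda>y. norm (\<phi> y *\<^sub>R H y))"
      using integrable_abs[OF Lp_mult_integrable[OF q \<phi> normH]] by (simp add: abs_mult)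
    then have "integrable M (\<lambda>y. \<phi> y *\<^sub>R H y)"
      by (subst integrable_norm_iff[symmetric]) simp_all
    then show ?thesis
      by (simp add: grad[OF \<phi>] integral_inner_left[symmetric] del: integral_inner_left)
  qed
  show "grad_const_dir M P q x l = Lp_norm M q (\<lambda>y. H y \<bullet> l)"
    unfolding grad_const_dir_def
    by (rule Least_equality)
      (auto simp: grad_l intro!: Lp_norm_le_dual_bound[OF q Hl A] Holder_inequality[OF q _ Hl])
  assume t: "norm t = 1"
    and le: "\<And>l. norm l = 1 \<Longrightarrow> Lp_norm M q (\<lambda>y. H y \<bullet> l) \<le> Lp_norm M q (\<lambda>y. H y \<bullet> t)"
  show "grad_const M P q x = Lp_norm M q (\<lambda>y. H y \<bullet> t)"
    unfolding grad_const_def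
  proof (rule Least_equality)
    show "\<forall>\<phi>\<in>Lp_space M ?p. norm (gradient (P \<phi>) x) \<le> Lp_norm M q (\<lambda>y. H y \<bullet> t) * Lp_norm M ?p \<phi>"
    proof
      fix \<phi> assume \<phi>: "\<phi> \<in> Lp_space M ?p"
      let ?v = "gradient (P \<phi>) x"
      show "norm ?v \<le> Lp_norm M q (\<lambda>y. H y \<bullet> t) * Lp_norm M ?p \<phi>"
      proof (cases "?v = 0")
        case True
        then show ?thesis by (simp add: Lp_norm_nonneg)
      next
        case False
        have "norm ?v = ?v \<bullet> sgn ?v"
          using False by (simp add: sgn_div_norm power2_norm_eq_inner[symmetric] power2_eq_square)
        also have "\<dots> \<le> \<bar>\<integral>y. \<phi> y * (H y \<bullet> sgn ?v) \<partial>M\<bar>"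
          by (simp add: grad_l[OF \<phi>])
        also have "\<dots> \<le> Lp_norm M q (\<lambda>y. H y \<bullet> sgn ?v) * Lp_norm M ?p \<phi>"
          by (rule Holder_inequality[OF q \<phi> Hl])
        also have "\<dots> \<le> Lp_norm M q (\<lambda>y. H y \<bullet> t) * Lp_norm M ?p \<phi>"
          using False by (intro mult_right_mono le Lp_norm_nonneg) (simp add: norm_sgn)
        finally show ?thesis .
      qed
    qed
  next
    fix C assume C: "\<forall>\<phi>\<in>Lp_space M ?p. norm (gradient (P \<phi>) x) \<le> C * Lp_norm M ?p \<phi>"
    have ge: "\<bar>\<integral>y. \<phi> y * (H y \<bullet> t) \<partial>M\<bar> \<le> C * Lp_norm M ?p \<phi>" if "\<phi> \<in> Lp_space M ?p" for \<phi>
      using C that Cauchy_Schwarz_ineq2[of "gradient (P \<phi>) x" t] t by (fastforce simp: grad_l[OF that])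
    show "Lp_norm M q (\<lambda>y. H y \<bullet> t) \<le> C"
      by (rule Lp_norm_le_dual_bound[OF q Hl A ge])
  qed
qed

section \<open>Rearrangement on the sphere\<close>

text \<open>Reflection in the hyperplane orthogonal to v, where v is not normalised. For v = 0,
  division by 0 makes it the identity, so \<open>reflect_swap\<close> also holds for equal
  vectors.\<close>

definition reflect :: "'a::euclidean_space \<Rightarrow> 'a \<Rightarrow> 'a" where
  "reflect v z = z - (2 * (z \<bullet> v) / (v \<bullet> v)) *\<^sub>R v"

lemma inner_reflect: "reflect v z \<bullet> y = z \<bullet> reflect v y"
  by (simp add: reflect_def inner_diff_left inner_diff_right inner_commute)

lemma reflect_orthogonal: "y \<bullet> v = 0 \<Longrightarrow> reflect v y = y"
  by (simp add: reflect_def)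

lemma reflect_add: "reflect v (y + z) = reflect v y + reflect v z"
  by (simp add: reflect_def inner_add_left add_divide_distrib algebra_simps)

lemma reflect_scaleR: "reflect v (c *\<^sub>R y) = c *\<^sub>R reflect v y"
  by (simp add: reflect_def algebra_simps)

lemma reflect_self: "reflect v v = - v"
  by (cases "v = 0") (simp_all add: reflect_def scaleR_2 algebra_simps)

lemma reflect_uminus: "reflect (- v) = reflect v"
  by (simp add: reflect_def fun_eq_iff)

lemma reflect_scaleR_axis: "c \<noteq> 0 \<Longrightarrow> reflect (c *\<^sub>R v) = reflect v"
  by (simp add: reflect_def fun_eq_iff)

lemma reflect_reflect: "reflect v (reflect v z) = z"
proof -
  have "reflect v (z + (- (2 * (z \<bullet> v) / (v \<bullet> v))) *\<^sub>R v) = z"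
    unfolding reflect_add reflect_scaleR reflect_self by (simp add: reflect_def)
  then show ?thesis by (simp add: reflect_def)
qed

lemma norm_reflect: "norm (reflect v z) = norm z"
  by (simp add: norm_eq_sqrt_inner inner_reflect reflect_reflect)

lemma reflect_swap:
  assumes "norm a = norm b" shows "reflect (a - b) a = b"
proof (cases "a = b")
  case False
  have *: "a \<bullet> a = b \<bullet> b" using assms by (simp add: norm_eq)
  have "(a - b) \<bullet> (a - b) = 2 * (a \<bullet> (a - b))"
    using * by (simp add: inner_diff_left inner_diff_right inner_commute)
  moreover have "(a - b) \<bullet> (a - b) \<noteq> 0"
    using inner_eq_zero_iff[of "a - b"] False by (metis right_minus_eq)
  ultimately have "2 * (a \<bullet> (a - b)) / ((a - b) \<bullet> (a - b)) = 1"
    by (metis divide_self)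
  then show ?thesis
    unfolding reflect_def by (simp only: scaleR_one diff_diff_eq2 add_diff_cancel_left')
qed (simp add: reflect_def)

lemma reflect_swap': "norm a = norm b \<Longrightarrow> reflect (a - b) b = a"
  using reflect_swap[of b a] reflect_uminus[of "a - b"] by simp

lemma measurable_reflect [measurable]: "reflect v \<in> borel_measurable borel"
  unfolding reflect_def by measurable

text \<open>The derivative has the sign of
  \<open>(A + x) powr (a - 1) - (A - x) powr (a - 1)\<close>, nonpositive because a - 1 \<le> 0;
  this is where the range of q takes effect. At v = A, where the second power may fail to be
  differentiable, continuity suffices.\<close>

lemma powr_sum_antimono:
  fixes A u v a :: real
  assumes "0 < a" "a \<le> 1" "0 \<le> u" "u \<le> v" "v \<le> A"
  shows "(A + v) powr a + (A - v) powr a \<le> (A + u) powr a + (A - u) powr a"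
proof (rule DERIV_nonpos_imp_decreasing_open[OF \<open>u \<le> v\<close>])
  fix x assume x: "u < x" "x < v"
  have "(A + x) powr (a - 1) \<le> (A - x) powr (a - 1)"
    using x assms by (intro powr_mono2') auto
  then have "a * (A + x) powr (a - 1) - a * (A - x) powr (a - 1) \<le> 0"
    using assms(1) by (simp add: mult_left_mono)
  moreover have "((\<lambda>x. (A + x) powr a + (A - x) powr a) has_real_derivative
      a * (A + x) powr (a - 1) - a * (A - x) powr (a - 1)) (at x)"
    using x assms by (auto intro!: derivative_eq_intros simp: powr_diff field_simps)
  ultimately show "\<exists>y. ((\<lambda>x. (A + x) powr a + (A - x) powr a) has_real_derivative y) (at x) \<and> y \<le> 0"
    by blast
next
  show "continuous_on {u..v} (\<lambda>x. (A + x) powr a + (A - x) powr a)"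
    using assms by (intro continuous_on_add continuous_on_powr' continuous_on_const continuous_on_id continuous_on_diff) auto
qed

lemma powr_even_part_antimono:
  fixes A B s s' a :: real
  assumes "0 < a" "a \<le> 1" "\<bar>B\<bar> \<le> A" "\<bar>s\<bar> \<le> \<bar>s'\<bar>" "\<bar>s'\<bar> \<le> 1"
  shows "(A + B * s') powr a + (A + B * - s') powr a \<le> (A + B * s) powr a + (A + B * - s) powr a"
proof -
  have eq: "(A + B * r) powr a + (A + B * - r) powr a = (A + \<bar>B * r\<bar>) powr a + (A - \<bar>B * r\<bar>) powr a" for r
    by (cases "0 \<le> B * r") auto
  have "\<bar>B * s\<bar> \<le> \<bar>B * s'\<bar>"
    using assms by (simp add: abs_mult mult_left_mono)
  moreover have "\<bar>B * s'\<bar> \<le> A"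
    using mult_left_mono[OF assms(5), of "\<bar>B\<bar>"] assms(3) by (simp add: abs_mult)
  ultimately show ?thesis
    unfolding eq using assms by (intro powr_sum_antimono) auto
qed

lemma abs_inner_le_1: "norm z = 1 \<Longrightarrow> norm l = 1 \<Longrightarrow> \<bar>z \<bullet> l\<bar> \<le> 1"
  using Cauchy_Schwarz_ineq2[of z l] by simp

text \<open>Both bounds come from \<open>compare\<close>. For the minimum, the reflection exchanges
  e and l. For the maximum, it exchanges l with \<open>t'\<close>, the direction of the part of l
  orthogonal to e, and a further reflection turns \<open>t'\<close> into t.\<close>

lemma
  fixes N :: "'a::euclidean_space measure" and w :: "real \<Rightarrow> real"
  assumes N: "finite_measure N" and sets_N [measurable_cong]: "sets N = sets borel"
    and unit: "AE z in N. norm z = 1"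
    and inv: "\<And>v. distr N borel (reflect v) = N"
    and w [measurable]: "w \<in> borel_measurable borel"
    and w_bound: "\<And>s. \<bar>s\<bar> \<le> 1 \<Longrightarrow> \<bar>w s\<bar> \<le> C"
    and w_anti: "\<And>s s'. \<bar>s\<bar> \<le> \<bar>s'\<bar> \<Longrightarrow> \<bar>s'\<bar> \<le> 1 \<Longrightarrow> w s' + w (- s') \<le> w s + w (- s)"
    and q: "0 \<le> q" and e: "norm e = 1" and l: "norm l = 1"
  shows sphere_integral_min: "(\<integral>z. w (z \<bullet> e) * \<bar>z \<bullet> e\<bar> powr q \<partial>N) \<le> (\<integral>z. w (z \<bullet> e) * \<bar>z \<bullet> l\<bar> powr q \<partial>N)"
    and sphere_integral_max: "norm t = 1 \<Longrightarrow> t \<bullet> e = 0 \<Longrightarrow>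
      (\<integral>z. w (z \<bullet> e) * \<bar>z \<bullet> l\<bar> powr q \<partial>N) \<le> (\<integral>z. w (z \<bullet> e) * \<bar>z \<bullet> t\<bar> powr q \<partial>N)"
proof -
  interpret N: finite_measure N by (rule N)
  define W where "W s = w s + w (- s)" for s
  have [measurable]: "W \<in> borel_measurable borel"
    unfolding W_def by measurable
  define J where "J a l = (\<integral>z. W (z \<bullet> a) * \<bar>z \<bullet> l\<bar> powr q \<partial>N)" for a l
  have integral_inv: "(\<integral>z. f (reflect v z) \<partial>N) = (\<integral>z. f z \<partial>N)"
    if "f \<in> borel_measurable borel" for f :: "'a \<Rightarrow> real" and v
  proof -
    have "(\<integral>z. f z \<partial>N) = (\<integral>z. f z \<partial>distr N borel (reflect v))"
      by (simp add: inv)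
    also have "\<dots> = (\<integral>z. f (reflect v z) \<partial>N)"
      using that by (intro integral_distr) measurable
    finally show ?thesis by simp
  qed
  have J_inv: "J (reflect v a) (reflect v l) = J a l" for v a l
    unfolding J_def using integral_inv[of "\<lambda>z. W (z \<bullet> a) * \<bar>z \<bullet> l\<bar> powr q" v] by (simp add: inner_reflect)
  have integrable: "integrable N (\<lambda>z. k (z \<bullet> a) * \<bar>z \<bullet> l\<bar> powr q)"
    if [measurable]: "k \<in> borel_measurable borel" and k: "\<And>s. \<bar>s\<bar> \<le> 1 \<Longrightarrow> \<bar>k s\<bar> \<le> D"
      and a: "norm a = 1" and l: "norm l = 1" for a l :: 'a and k :: "real \<Rightarrow> real" and D
  proof (rule N.integrable_const_bound[where B = D])
    show "AE z in N. norm (k (z \<bullet> a) * \<bar>z \<bullet> l\<bar> powr q) \<le> D"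
      using unit
    proof eventually_elim
      case (elim z)
      have "\<bar>z \<bullet> l\<bar> powr q \<le> 1"
        using powr_mono2[OF q abs_ge_zero abs_inner_le_1[OF elim l]] by simp
      then show ?case
        using mult_mono[OF k[OF abs_inner_le_1[OF elim a]], of "\<bar>z \<bullet> l\<bar> powr q" 1]
          k[OF abs_inner_le_1[OF elim a]] by (simp add: abs_mult)
    qed
  qed measurable
  have W_bound: "\<bar>W s\<bar> \<le> 2 * C" if "\<bar>s\<bar> \<le> 1" for s
    using w_bound[of s] w_bound[of "- s"] that by (simp add: W_def)
  \<comment> \<open>The reflections along e and along the part of l orthogonal to e compose to a map
    sending e to -e and l to -l. The factor in l is even, so w (s) and w (-s) give the same
    integral.\<close>
  have sym: "J e l = 2 * (\<integral>z. w (z \<bullet> e) * \<bar>z \<bullet> l\<bar> powr q \<partial>N)" if l: "norm l = 1" for l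
  proof -
    let ?v = "l - (l \<bullet> e) *\<^sub>R e"
    have ev: "e \<bullet> ?v = 0" using e by (simp add: inner_diff_right power2_norm_eq_inner[symmetric] inner_commute)
    have re: "reflect ?v (reflect e e) = - e"
      using reflect_orthogonal[OF ev] reflect_scaleR[of ?v "-1" e] by (simp add: reflect_self)
    have "reflect e l = reflect e ?v + (l \<bullet> e) *\<^sub>R reflect e e"
      using reflect_add[of e ?v "(l \<bullet> e) *\<^sub>R e"] by (simp add: reflect_scaleR)
    also have "\<dots> = ?v + (l \<bullet> e) *\<^sub>R (- e)"
      using ev by (simp add: reflect_orthogonal inner_commute reflect_self)
    finally have "reflect ?v (reflect e l) = reflect ?v ?v + (- (l \<bullet> e)) *\<^sub>R reflect ?v e"
      by (simp only: reflect_add reflect_scaleR) (simp add: reflect_scaleR[of _ "-1" e, simplified] )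
    also have "\<dots> = - l"
      using reflect_orthogonal[OF ev] by (simp add: reflect_self)
    finally have rl: "reflect ?v (reflect e l) = - l" .
    have "(\<integral>z. w (z \<bullet> e) * \<bar>z \<bullet> l\<bar> powr q \<partial>N) = (\<integral>z. w (reflect e z \<bullet> e) * \<bar>reflect e z \<bullet> l\<bar> powr q \<partial>N)"
      by (rule integral_inv[symmetric, of "\<lambda>z. w (z \<bullet> e) * \<bar>z \<bullet> l\<bar> powr q"]) measurable
    also have "\<dots> = (\<integral>z. w (reflect e (reflect ?v z) \<bullet> e) * \<bar>reflect e (reflect ?v z) \<bullet> l\<bar> powr q \<partial>N)"
      by (rule integral_inv[symmetric, of "\<lambda>z. w (reflect e z \<bullet> e) * \<bar>reflect e z \<bullet> l\<bar> powr q"]) measurable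
    also have "\<dots> = (\<integral>z. w (- (z \<bullet> e)) * \<bar>z \<bullet> l\<bar> powr q \<partial>N)"
      by (simp add: inner_reflect re rl)
    finally have "(\<integral>z. w (z \<bullet> e) * \<bar>z \<bullet> l\<bar> powr q \<partial>N) = (\<integral>z. w (- (z \<bullet> e)) * \<bar>z \<bullet> l\<bar> powr q \<partial>N)" .
    moreover have "J e l = (\<integral>z. w (z \<bullet> e) * \<bar>z \<bullet> l\<bar> powr q \<partial>N) + (\<integral>z. w (- (z \<bullet> e)) * \<bar>z \<bullet> l\<bar> powr q \<partial>N)"
      unfolding J_def W_def distrib_right
      using w_bound by (intro Bochner_Integration.integral_add integrable e l
          integrable[where k = "\<lambda>s. w (- s)" and D = C]) auto
    ultimately show ?thesis by simp
  qed
  \<comment> \<open>The product of differences is nonnegative because W decreases in the absolute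
    value of its argument and \<open>sign\<close> orders the two pairs alike. Expanded and
    integrated, it is 2 (\<open>J a l'\<close> - \<open>J a l\<close>) by the two symmetry
    assumptions.\<close>
  have compare: "J a l \<le> J a l'"
    if units: "norm a = 1" "norm a' = 1" "norm l = 1" "norm l' = 1"
      and "J a l = J a' l'" "J a l' = J a' l"
      and sign: "\<And>z. norm z = 1 \<Longrightarrow> \<bar>z \<bullet> a\<bar> \<le> \<bar>z \<bullet> a'\<bar> \<longleftrightarrow> \<bar>z \<bullet> l\<bar> \<le> \<bar>z \<bullet> l'\<bar>" for a a' l l'
  proof -
    have int: "integrable N (\<lambda>z. W (z \<bullet> b) * \<bar>z \<bullet> k\<bar> powr q)" if "norm b = 1" "norm k = 1" for b k
      using W_bound that by (intro integrable) auto
    have "0 \<le> (\<integral>z. (W (z \<bullet> a) - W (z \<bullet> a')) * (\<bar>z \<bullet> l'\<bar> powr q - \<bar>z \<bullet> l\<bar> powr q) \<partial>N)"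
    proof (rule integral_nonneg_AE)
      show "AE z in N. 0 \<le> (W (z \<bullet> a) - W (z \<bullet> a')) * (\<bar>z \<bullet> l'\<bar> powr q - \<bar>z \<bullet> l\<bar> powr q)"
        using unit
      proof eventually_elim
        case (elim z)
        show ?case
        proof (cases "\<bar>z \<bullet> a\<bar> \<le> \<bar>z \<bullet> a'\<bar>")
          case True
          then show ?thesis
            using sign[OF elim] w_anti[OF True abs_inner_le_1[OF elim units(2)]] q
            by (intro mult_nonneg_nonneg) (simp_all add: W_def powr_mono2)
        next
          case False
          then have "\<bar>z \<bullet> a'\<bar> \<le> \<bar>z \<bullet> a\<bar>" by simp
          then show ?thesis
            using sign[OF elim] False w_anti[OF _ abs_inner_le_1[OF elim units(1)]] q
            by (intro mult_nonpos_nonpos) (simp_all add: W_def powr_mono2)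
        qed
      qed
    qed
    also have "\<dots> = (\<integral>z. W (z \<bullet> a) * \<bar>z \<bullet> l'\<bar> powr q - W (z \<bullet> a) * \<bar>z \<bullet> l\<bar> powr q
        - (W (z \<bullet> a') * \<bar>z \<bullet> l'\<bar> powr q - W (z \<bullet> a') * \<bar>z \<bullet> l\<bar> powr q) \<partial>N)"
      by (simp add: algebra_simps)
    also have "\<dots> = J a l' - J a l - (J a' l' - J a' l)"
      unfolding J_def by (simp add: int units)
    finally show ?thesis using that by simp
  qed
  have "J e e \<le> J e l"
  \<comment> \<open>Here the weight and the test direction run through the same pair e, l, so the
    sign condition is one inequality stated twice.\<close>
  proof (rule compare[OF e l e l])
    show "J e e = J l l"
      using J_inv[of "e - l" e e] by (simp add: reflect_swap e l)
    show "J e l = J l e"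
      using J_inv[of "e - l" e l] by (simp add: reflect_swap reflect_swap' e l)
  qed simp
  then show "(\<integral>z. w (z \<bullet> e) * \<bar>z \<bullet> e\<bar> powr q \<partial>N) \<le> (\<integral>z. w (z \<bullet> e) * \<bar>z \<bullet> l\<bar> powr q \<partial>N)"
    by (simp add: sym e l)
  assume t: "norm t = 1" "t \<bullet> e = 0"
  obtain t' s where t': "norm t' = 1" "t' \<bullet> e = 0" and l_eq: "l = (l \<bullet> e) *\<^sub>R e + s *\<^sub>R t'"
  proof (cases "l - (l \<bullet> e) *\<^sub>R e = 0")
    \<comment> \<open>For l parallel to e there is no tangential part, and t itself is taken with
      coefficient 0.\<close>
    case True
    then show ?thesis using that[of t 0] t by simp
  next
    case False
    let ?v = "l - (l \<bullet> e) *\<^sub>R e"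
    have "?v \<bullet> e = 0" using e by (simp add: inner_diff_left power2_norm_eq_inner[symmetric])
    then show ?thesis using that[of "sgn ?v" "norm ?v"] False by (simp add: norm_sgn sgn_div_norm)
  qed
  define c where "c = l \<bullet> e"
  have le: "l = c *\<^sub>R e + s *\<^sub>R t'" using l_eq by (simp add: c_def)
  have ee: "e \<bullet> e = 1" "t' \<bullet> t' = 1" "e \<bullet> t' = 0"
    using e t' by (simp_all add: power2_norm_eq_inner[symmetric] inner_commute)
  have "l \<bullet> l = 1" using l by (simp add: power2_norm_eq_inner[symmetric])
  then have cs: "c * c + s * s = 1"
    unfolding le by (simp add: inner_add_left inner_add_right ee inner_commute)
  define e' where "e' = reflect (l - t') e"
  have e'_norm: "norm e' = 1"
    using e by (simp add: e'_def norm_reflect)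
  \<comment> \<open>\<open>e'\<close> is a unit vector orthogonal to l in the plane of e and
    \<open>t'\<close>. For s = 1 the reflection is the identity and \<open>e'\<close> is e, whereas
    the formula would give -e.\<close>
  have e'_eq: "e' = (- s) *\<^sub>R e + c *\<^sub>R t'" if "s \<noteq> 1"
  proof -
    have lt: "l - t' = c *\<^sub>R e + (s - 1) *\<^sub>R t'" by (simp add: le algebra_simps)
    have "e \<bullet> (l - t') = c" "(l - t') \<bullet> (l - t') = c * c + (s - 1) * (s - 1)"
      unfolding lt by (simp_all add: inner_add_left inner_add_right ee inner_commute)
    moreover have "c * c + (s - 1) * (s - 1) = 2 * (1 - s)"
      using cs by (simp add: algebra_simps)
    moreover have "2 * c / (2 * (1 - s)) = c / (1 - s)"
      by (rule mult_divide_mult_cancel_left) simp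
    ultimately have "e' = e - (c / (1 - s)) *\<^sub>R (c *\<^sub>R e + (s - 1) *\<^sub>R t')"
      unfolding e'_def reflect_def by (simp only: lt)
    also have "\<dots> = (1 - c * c / (1 - s)) *\<^sub>R e + (c * (1 - s) / (1 - s)) *\<^sub>R t'"
      by (simp add: algebra_simps diff_divide_distrib)
    also have "c * c = (1 - s) * (1 + s)"
      using cs by (simp add: algebra_simps)
    finally show ?thesis
      using that by simp
  qed
  have "J e l \<le> J e t'"
  proof (rule compare[OF e e'_norm l t'(1)])
    show "J e l = J e' t'"
      using J_inv[of "l - t'" e l] by (simp add: reflect_swap l t' e'_def)
    show "J e t' = J e' l"
      using J_inv[of "l - t'" e t'] by (simp add: reflect_swap' l t' e'_def)
    fix z
    \<comment> \<open>The pairs (\<open>e'\<close>, l) and (e, \<open>t'\<close>) are orthonormal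
      bases of one plane. With the sum of squares fixed, one coordinate grows exactly when the other
      shrinks, which is the sign condition.\<close>
    have "(z \<bullet> e')\<^sup>2 + (z \<bullet> l)\<^sup>2 = (z \<bullet> e)\<^sup>2 + (z \<bullet> t')\<^sup>2"
    proof (cases "s = 1")
      case True
      then have "c = 0" using cs by simp
      then have "l = t'" using le True by simp
      then show ?thesis by (simp add: e'_def reflect_def)
    next
      case False
      have "(z \<bullet> e')\<^sup>2 + (z \<bullet> l)\<^sup>2 = (c * c + s * s) * ((z \<bullet> e)\<^sup>2 + (z \<bullet> t')\<^sup>2)"
        unfolding e'_eq[OF False] by (subst le) (simp add: inner_add_right power2_eq_square algebra_simps)
      then show ?thesis by (simp add: cs)
    qed
    then have "(z \<bullet> e)\<^sup>2 \<le> (z \<bullet> e')\<^sup>2 \<longleftrightarrow> (z \<bullet> l)\<^sup>2 \<le> (z \<bullet> t')\<^sup>2"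
      by auto
    then show "\<bar>z \<bullet> e\<bar> \<le> \<bar>z \<bullet> e'\<bar> \<longleftrightarrow> \<bar>z \<bullet> l\<bar> \<le> \<bar>z \<bullet> t'\<bar>"
      by (simp add: abs_le_square_iff)
  qed
  \<comment> \<open>The reflection along \<open>t - t'\<close> fixes e and exchanges the two
    tangential directions.\<close>
  also have "J e t' = J e t"
    using J_inv[of "t - t'" e t] reflect_orthogonal[of e "t - t'"] t t'
    by (simp add: reflect_swap inner_diff_right inner_commute)
  finally show "(\<integral>z. w (z \<bullet> e) * \<bar>z \<bullet> l\<bar> powr q \<partial>N) \<le> (\<integral>z. w (z \<bullet> e) * \<bar>z \<bullet> t\<bar> powr q \<partial>N)"
    by (simp add: sym l t)
qed

text \<open>Interface between the two geometries and the rearrangement: \<open>push\<close> carries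
  the q-th power of every directional norm to the sphere, and the norms are ordered like the sphere
  integrals because k is nonnegative.\<close>

lemma
  fixes H :: "'b \<Rightarrow> 'a::euclidean_space" and N :: "'a measure"
  assumes q: "1 < q"
    and grad: "\<And>\<phi>. \<phi> \<in> Lp_space M (conj_exp q) \<Longrightarrow> gradient (P \<phi>) x = (\<integral>y. \<phi> y *\<^sub>R H y \<partial>M)"
    and H: "H \<in> borel_measurable M" "integrable M (\<lambda>y. norm (H y) powr q)"
    and S: "S \<in> sets M" "0 < measure M S"
    and N: "finite_measure N" "sets N = sets borel" "AE z in N. norm z = 1" "\<And>v. distr N borel (reflect v) = N"
    and a: "0 < a" "a \<le> 1" and AB: "\<bar>B\<bar> \<le> A" and k: "0 \<le> k"
    and push: "\<And>l. (\<integral>y. \<bar>H y \<bullet> l\<bar> powr q \<partial>M) = k * (\<integral>z. (A + B * (z \<bullet> e)) powr a * \<bar>z \<bullet> l\<bar> powr q \<partial>N)"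
    and e: "norm e = 1"
  shows grad_const_extremal: "norm l = 1 \<Longrightarrow> norm t = 1 \<Longrightarrow> t \<bullet> e = 0 \<Longrightarrow>
    grad_const_dir M P q x e \<le> grad_const_dir M P q x l \<and>
    grad_const_dir M P q x (- e) \<le> grad_const_dir M P q x l \<and>
    grad_const_dir M P q x l \<le> grad_const_dir M P q x t \<and>
    grad_const_dir M P q x t = grad_const M P q x"
proof -
  let ?F = "\<lambda>l. \<integral>z. (A + B * (z \<bullet> e)) powr a * \<bar>z \<bullet> l\<bar> powr q \<partial>N"
  have dir: "grad_const_dir M P q x l = Lp_norm M q (\<lambda>y. H y \<bullet> l)" for l
    by (rule grad_const_dir_eq[where H = H, OF q grad H S])
  have F0: "0 \<le> ?F l" for l
    by (intro integral_nonneg_AE) simp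
  have norm_mono: "Lp_norm M q (\<lambda>y. H y \<bullet> l) \<le> Lp_norm M q (\<lambda>y. H y \<bullet> l')" if "?F l \<le> ?F l'" for l l'
    unfolding Lp_norm_def push using that q k F0[of l] by (intro powr_mono2 mult_left_mono) auto
  let ?w = "\<lambda>s. (A + B * s) powr a"
  \<comment> \<open>The condition |B| \<le> A keeps the base of the power between 0 and 2 A.\<close>
  have w_bound: "\<bar>?w s\<bar> \<le> (2 * A) powr a" if "\<bar>s\<bar> \<le> 1" for s
  proof -
    have "\<bar>B * s\<bar> \<le> A"
      using mult_mono[OF AB that] AB by (simp add: abs_mult)
    then have "?w s \<le> (2 * A) powr a"
      using a by (intro powr_mono2) (auto simp: abs_le_iff)
    then show ?thesis by simp
  qed
  have minimal: "?F e \<le> ?F l" if "norm l = 1" for l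
    using powr_even_part_antimono[OF a AB] w_bound q
    by (intro sphere_integral_min[OF N, where w = ?w] e that) auto
  have maximal: "?F l \<le> ?F t" if "norm l = 1" "norm t = 1" "t \<bullet> e = 0" for l t
    using powr_even_part_antimono[OF a AB] w_bound q
    by (intro sphere_integral_max[OF N, where w = ?w] e that) auto
  assume l: "norm l = 1" and t: "norm t = 1" "t \<bullet> e = 0"
  have "grad_const M P q x = Lp_norm M q (\<lambda>y. H y \<bullet> t)"
    by (rule grad_const_eq[where H = H, OF q grad H S t(1)]) (simp_all add: norm_mono maximal t)
  moreover have "Lp_norm M q (\<lambda>y. H y \<bullet> - e) = Lp_norm M q (\<lambda>y. H y \<bullet> e)"
    by (simp add: Lp_norm_def)
  ultimately show ?thesis
    unfolding dir using minimal[OF l] maximal[OF l t] by (auto intro!: norm_mono)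
qed

section \<open>Conformal changes of variables and inversions\<close>

lemma orthogonal_transformation_reflect: "orthogonal_transformation (reflect v)"
  by (auto simp: orthogonal_transformation_def inner_reflect reflect_reflect
      intro!: linearI reflect_add reflect_scaleR)

text \<open>With equal stretching in all directions the distinguished direction is arbitrary; a
  basis vector stands in for it.\<close>

lemma change_of_variables_conformal:
  fixes g :: "'a::euclidean_space \<Rightarrow> 'a" and f :: "'a \<Rightarrow> real"
  assumes "S \<in> sets borel" "T \<in> sets borel" "g ` S = T" "inj_on g S"
    and "f \<in> borel_measurable borel" "g \<in> borel_measurable borel" "a \<in> borel_measurable borel"
    and Q: "\<And>x. x \<in> S \<Longrightarrow> orthogonal_transformation (Q x)"
    and deriv: "\<And>x. x \<in> S \<Longrightarrow> (g has_derivative (\<lambda>h. a x *\<^sub>R Q x h)) (at x)"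
  shows "set_integrable lborel S (\<lambda>x. \<bar>a x\<bar> ^ DIM('a) * f (g x)) \<longleftrightarrow> set_integrable lborel T f"
    and "(LINT x:S|lborel. \<bar>a x\<bar> ^ DIM('a) * f (g x)) = (LINT x:T|lborel. f x)"
proof -
  obtain b :: 'a where b: "b \<in> Basis" using nonempty_Basis by blast
  have "(g has_derivative (\<lambda>h. Q x (a x *\<^sub>R h + ((a x - a x) * (b \<bullet> h)) *\<^sub>R b))) (at x)" if "x \<in> S" for x
    using deriv[OF that] Q[OF that] by (simp add: orthogonal_transformation_scaleR)
  note * = change_of_variables_dilation[where z = "\<lambda>x. b" and b = a, OF assms(1-7,7) _ Q this]
  have "\<bar>a x\<bar> ^ DIM('a) = \<bar>a x\<bar> ^ (DIM('a) - 1) * \<bar>a x\<bar>" for x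
    using DIM_positive[where 'a='a] by (metis Suc_pred' power_Suc2)
  then show "set_integrable lborel S (\<lambda>x. \<bar>a x\<bar> ^ DIM('a) * f (g x)) \<longleftrightarrow> set_integrable lborel T f"
    and "(LINT x:S|lborel. \<bar>a x\<bar> ^ DIM('a) * f (g x)) = (LINT x:T|lborel. f x)"
    using * b by simp_all
qed

lemma set_integral_AE:
  fixes f :: "'a \<Rightarrow> real"
  assumes "AE x in M. x \<in> S" "S \<in> sets M" "f \<in> borel_measurable M"
  shows "(LINT x:S|M. f x) = (LINT x|M. f x)"
  unfolding set_lebesgue_integral_def
proof (rule integral_cong_AE)
  show "AE x in M. indicat_real S x *\<^sub>R f x = f x"
    using assms(1) by eventually_elim simp
qed (use assms in simp_all)

text \<open>The transformation rule concerns Bochner integrals, so equality of image measures is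
  reduced to real integrals of indicators; integrability of K keeps all values finite.\<close>

lemma distr_density_cong:
  fixes K :: "'a::euclidean_space \<Rightarrow> real" and f g :: "'a \<Rightarrow> 'b::topological_space"
  assumes K: "integrable lborel K" and K0: "\<And>x. 0 \<le> K x"
    and f [measurable]: "f \<in> borel_measurable borel" and g [measurable]: "g \<in> borel_measurable borel"
    and eq: "\<And>A. A \<in> sets borel \<Longrightarrow>
      (\<integral>x. K x * indicator A (f x) \<partial>lborel) = (\<integral>x. K x * indicator A (g x) \<partial>lborel)"
  shows "distr (density lborel K) borel f = distr (density lborel K) borel g"
proof (rule measure_eqI)
  have [measurable]: "K \<in> borel_measurable lborel" using K by simp
  have em: "emeasure (distr (density lborel K) borel h) A = ennreal (\<integral>x. K x * indicator A (h x) \<partial>lborel)"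
    if [measurable]: "A \<in> sets borel" "h \<in> borel_measurable borel" for A and h :: "'a \<Rightarrow> 'b"
  proof -
    have [measurable]: "h -` A \<in> sets borel"
      using measurable_sets[OF that(2,1)] by simp
    have "emeasure (distr (density lborel K) borel h) A = (\<integral>\<^sup>+x. ennreal (K x) * indicator (h -` A) x \<partial>lborel)"
      by (simp add: emeasure_distr emeasure_density)
    also have "\<dots> = (\<integral>\<^sup>+x. ennreal (K x * indicator A (h x)) \<partial>lborel)"
      by (intro nn_integral_cong) (simp add: indicator_def)
    also have "\<dots> = ennreal (\<integral>x. K x * indicator A (h x) \<partial>lborel)"
    proof (rule nn_integral_eq_integral)
      show "integrable lborel (\<lambda>x. K x * indicator A (h x))"
        using K by (rule Bochner_Integration.integrable_bound) (auto simp: indicator_def K0)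
    qed (simp add: K0)
    finally show ?thesis .
  qed
  fix A assume "A \<in> sets (distr (density lborel K) borel f)"
  then have [measurable]: "A \<in> sets borel" by simp
  show "emeasure (distr (density lborel K) borel f) A = emeasure (distr (density lborel K) borel g) A"
    by (simp add: em eq)
qed simp

text \<open>The Jacobian of g turns K into itself, so g preserves the measure with density K, and
  \<eta> intertwines g with the reflection; hence the image measure is invariant.\<close>

lemma distr_density_reflect:
  fixes K :: "'a::euclidean_space \<Rightarrow> real" and \<eta> :: "'a \<Rightarrow> 'b::euclidean_space"
  assumes K: "integrable lborel K" and K0: "\<And>x. 0 \<le> K x"
    and \<eta> [measurable]: "\<eta> \<in> borel_measurable borel"
    and S [measurable]: "S \<in> sets borel" "AE x in lborel. x \<in> S" and gS: "g ` S = S" "inj_on g S"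
    and g [measurable]: "g \<in> borel_measurable borel" and a [measurable]: "a \<in> borel_measurable borel"
    and Q: "\<And>x. x \<in> S \<Longrightarrow> orthogonal_transformation (Q x)"
    and deriv: "\<And>x. x \<in> S \<Longrightarrow> (g has_derivative (\<lambda>h. a x *\<^sub>R Q x h)) (at x)"
    and K_g: "\<And>x. x \<in> S \<Longrightarrow> \<bar>a x\<bar> ^ DIM('a) * K (g x) = K x"
    and \<eta>_g: "\<And>x. x \<in> S \<Longrightarrow> \<eta> (g x) = reflect v (\<eta> x)"
  shows "distr (distr (density lborel K) borel \<eta>) borel (reflect v) = distr (density lborel K) borel \<eta>"
proof -
  have [measurable]: "K \<in> borel_measurable borel" using K by simp
  have "distr (density lborel K) borel (\<lambda>x. reflect v (\<eta> x)) = distr (density lborel K) borel \<eta>"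
  proof (rule distr_density_cong[OF K K0])
    fix A :: "'b set" assume [measurable]: "A \<in> sets borel"
    have "(\<integral>x. K x * indicator A (reflect v (\<eta> x)) \<partial>lborel) = (LINT x:S|lborel. K x * indicator A (reflect v (\<eta> x)))"
      using S by (subst set_integral_AE) auto
    also have "\<dots> = (LINT x:S|lborel. \<bar>a x\<bar> ^ DIM('a) * (K (g x) * indicator A (\<eta> (g x))))"
      by (intro set_lebesgue_integral_cong) (simp_all add: K_g \<eta>_g flip: mult.assoc)
    also have "\<dots> = (LINT x:S|lborel. K x * indicator A (\<eta> x))"
      by (rule change_of_variables_conformal(2)[where Q = Q, OF S(1) S(1) gS _ g a Q deriv]) auto
    also have "\<dots> = (\<integral>x. K x * indicator A (\<eta> x) \<partial>lborel)"
      using S by (subst set_integral_AE) auto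
    finally show "(\<integral>x. K x * indicator A (reflect v (\<eta> x)) \<partial>lborel) = (\<integral>x. K x * indicator A (\<eta> x) \<partial>lborel)" .
  qed measurable
  then show ?thesis
    by (simp add: distr_distr o_def)
qed

text \<open>For k > 0, inversion in the sphere of centre c and squared radius k. Division by 0 sends
  c to itself, so c is removed whenever this is a change of variables.\<close>

definition inversion :: "'a::euclidean_space \<Rightarrow> real \<Rightarrow> 'a \<Rightarrow> 'a" where
  "inversion c k y = c + (k / (norm (y - c))\<^sup>2) *\<^sub>R (y - c)"

lemma measurable_inversion [measurable]: "inversion c k \<in> borel_measurable borel"
  unfolding inversion_def by measurable

text \<open>Differentiating the scalar factor subtracts twice the projection onto y - c, which turns
  the identity into a reflection: inversions are conformal.\<close>

lemma has_derivative_inversion: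
  assumes "y \<noteq> c"
  shows "(inversion c k has_derivative (\<lambda>h. (k / (norm (y - c))\<^sup>2) *\<^sub>R reflect (y - c) h)) (at y)"
proof -
  have nz: "(y - c) \<bullet> (y - c) \<noteq> 0"
    using inner_eq_zero_iff[of "y - c"] assms by (metis right_minus_eq)
  have "((\<lambda>y. c + (k / ((y - c) \<bullet> (y - c))) *\<^sub>R (y - c)) has_derivative
      (\<lambda>h. (k / ((y - c) \<bullet> (y - c))) *\<^sub>R h +
        (- (k * (((y - c) \<bullet> h) + (h \<bullet> (y - c)))) / (((y - c) \<bullet> (y - c)) * ((y - c) \<bullet> (y - c)))) *\<^sub>R (y - c))) (at y)"
    using nz by (auto intro!: derivative_eq_intros simp: fun_eq_iff)
  moreover have "(k / d) *\<^sub>R h + (- (k * ((w \<bullet> h) + (h \<bullet> w))) / (d * d)) *\<^sub>R w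
      = (k / d) *\<^sub>R (h - (2 * (h \<bullet> w) / d) *\<^sub>R w)" for h w :: 'a and d
    by (simp add: scaleR_diff_right inner_commute[of w h] mult.assoc mult.left_commute[of k 2])
  ultimately show ?thesis
    unfolding inversion_def power2_norm_eq_inner reflect_def by simp
qed

lemma inversion_minus_center: "inversion c k y - c = (k / (norm (y - c))\<^sup>2) *\<^sub>R (y - c)"
  by (simp add: inversion_def)

lemma norm_inversion_minus_center: "norm (inversion c k y - c) = \<bar>k\<bar> / norm (y - c)"
  by (cases "y = c") (simp_all add: inversion_def power2_eq_square)

lemma inversion_neq_center: "y \<noteq> c \<Longrightarrow> k \<noteq> 0 \<Longrightarrow> inversion c k y \<noteq> c"
  by (simp add: inversion_def)

lemma inversion_inversion: "y \<noteq> c \<Longrightarrow> k \<noteq> 0 \<Longrightarrow> inversion c k (inversion c k y) = y"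
  unfolding inversion_def[of c k "inversion c k y"] norm_inversion_minus_center inversion_minus_center
  by (simp add: power_divide power2_eq_square)

lemma inversion_bij:
  assumes "k \<noteq> 0"
  shows "inversion c k ` (- {c}) = - {c}" "inj_on (inversion c k) (- {c})"
proof -
  show "inversion c k ` (- {c}) = - {c}"
  proof (intro equalityI subsetI)
    fix y assume "y \<in> - {c}"
    then show "y \<in> inversion c k ` (- {c})"
      using assms inversion_inversion[of y c k] inversion_neq_center[of y c k] by (intro image_eqI[of _ _ "inversion c k y"]) auto
  qed (use assms inversion_neq_center in auto)
  show "inj_on (inversion c k) (- {c})"
    using assms by (intro inj_on_inverseI[where g = "inversion c k"]) (simp add: inversion_inversion)
qed

section \<open>The half-space\<close>

definition hs_dist :: "'a::euclidean_space \<times> real \<Rightarrow> 'a \<Rightarrow> real" where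
  "hs_dist z y = (norm (fst z - y))\<^sup>2 + (snd z)\<^sup>2"

text \<open>The type \<open>'a\<close> is the boundary, so the exponent is n - 1.\<close>

definition hs_kernel :: "'a::euclidean_space \<times> real \<Rightarrow> 'a \<Rightarrow> real" where
  "hs_kernel z y = (snd z / hs_dist z y) ^ DIM('a)"

text \<open>With w = (y - \<open>fst z\<close>) / \<open>snd z\<close> this is (2 w, |w|^2 - 1) /
  (|w|^2 + 1), the inverse stereographic projection from the pole (0, 1). It is also the direction
  of the gradient of the kernel in z.\<close>

definition hs_dir :: "'a::euclidean_space \<times> real \<Rightarrow> 'a \<Rightarrow> 'a \<times> real" where
  "hs_dir z y = ((2 * snd z / hs_dist z y) *\<^sub>R (y - fst z), 1 - 2 * (snd z)\<^sup>2 / hs_dist z y)"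

lemma hs_dist_pos: "0 < snd z \<Longrightarrow> 0 < hs_dist z y"
  by (simp add: hs_dist_def add_nonneg_pos)

lemma hs_kernel_nonneg: "0 < snd z \<Longrightarrow> 0 \<le> hs_kernel z y"
  using hs_dist_pos[of z y] by (simp add: hs_kernel_def)

lemma measurable_hs [measurable]:
  "hs_dist z \<in> borel_measurable borel" "hs_kernel z \<in> borel_measurable borel" "hs_dir z \<in> borel_measurable borel"
  unfolding hs_dist_def hs_kernel_def hs_dir_def by measurable

lemma norm_hs_dir:
  assumes z: "0 < snd z" shows "norm (hs_dir z y) = 1"
proof -
  let ?D = "hs_dist z y" and ?s = "snd z"
  have D: "?D \<noteq> 0" using hs_dist_pos[OF z, of y] by simp
  have u: "(norm (y - fst z))\<^sup>2 = ?D - ?s\<^sup>2"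
    by (simp add: hs_dist_def norm_minus_commute)
  have "(norm (hs_dir z y))\<^sup>2 = (2 * ?s / ?D)\<^sup>2 * (norm (y - fst z))\<^sup>2 + (1 - 2 * ?s\<^sup>2 / ?D)\<^sup>2"
    by (simp add: hs_dir_def norm_Pair power_mult_distrib power_divide)
  also have "\<dots> = 1"
    unfolding u using D by (simp add: field_simps power2_eq_square)
  finally show ?thesis
    by (simp add: power2_eq_1_iff) (metis norm_ge_zero not_one_le_zero neg_0_le_iff_le)
qed

lemma GDERIV_hs_kernel:
  fixes z :: "'a::euclidean_space \<times> real"
  assumes z: "0 < snd z"
  shows "GDERIV (\<lambda>z. hs_kernel z y) z :> (DIM('a) * hs_kernel z y / snd z) *\<^sub>R hs_dir z y"
proof -
  let ?D = "hs_dist z y" and ?s = "snd z"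
  have D: "?D \<noteq> 0" using hs_dist_pos[OF z, of y] by simp
  have dist: "hs_dist z y = (fst z - y) \<bullet> (fst z - y) + snd z * snd z" for z
    unfolding hs_dist_def power2_norm_eq_inner by (simp only: power2_eq_square)
  have "((\<lambda>z. snd z / ((fst z - y) \<bullet> (fst z - y) + snd z * snd z)) has_derivative
     (\<lambda>h. (snd h * ?D - ?s * (2 * (fst h \<bullet> (fst z - y)) + 2 * ?s * snd h)) / (?D * ?D))) (at z)"
    using D unfolding dist by (auto intro!: derivative_eq_intros simp: fun_eq_iff inner_commute algebra_simps)
  moreover have "(snd h * ?D - ?s * (2 * (fst h \<bullet> (fst z - y)) + 2 * ?s * snd h)) / (?D * ?D)
      = h \<bullet> ((1 / ?D) *\<^sub>R hs_dir z y)" for h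
    using D by (simp add: hs_dir_def inner_prod_def field_simps power2_eq_square inner_diff_right)
  ultimately have "GDERIV (\<lambda>z. snd z / hs_dist z y) z :> (1 / ?D) *\<^sub>R hs_dir z y"
    by (simp only: gderiv_def dist)
  moreover have "DERIV (\<lambda>r. r ^ DIM('a)) (?s / ?D) :> DIM('a) * (?s / ?D) ^ (DIM('a) - 1)"
    by (auto intro!: derivative_eq_intros)
  ultimately have "GDERIV (\<lambda>z. (snd z / hs_dist z y) ^ DIM('a)) z :>
      (DIM('a) * (?s / ?D) ^ (DIM('a) - 1)) *\<^sub>R (1 / ?D) *\<^sub>R hs_dir z y"
    by (rule GDERIV_DERIV_compose)
  moreover have "(?s / ?D) ^ DIM('a) = (?s / ?D) ^ (DIM('a) - 1) * (?s / ?D)"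
    using DIM_positive[where 'a='a] by (metis Suc_pred' power_Suc2)
  ultimately show ?thesis
    using z by (simp add: hs_kernel_def)
qed

text \<open>The centre lies on the boundary at offset d from \<open>fst x\<close>, and k is its
  squared distance from x, so the inversion of the whole space fixes x. The identity is the
  distortion formula for distances under inversion, at this fixed point.\<close>

lemma hs_dist_inversion:
  assumes "y \<noteq> fst x + d" and k: "k = (norm d)\<^sup>2 + (snd x)\<^sup>2"
  shows "hs_dist x (inversion (fst x + d) k y) * (norm (y - (fst x + d)))\<^sup>2 = k * hs_dist x y"
proof -
  define w where "w = y - (fst x + d)"
  define W where "W = (norm w)\<^sup>2"
  have W: "W \<noteq> 0" using assms(1) by (simp add: w_def W_def)
  have 1: "hs_dist x y = W + 2 * (w \<bullet> d) + k"
  proof -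
    have "fst x - y = - (w + d)" by (simp add: w_def)
    then have "(norm (fst x - y))\<^sup>2 = (norm (w + d))\<^sup>2" by (simp only: norm_minus_cancel)
    then show ?thesis
      by (simp add: hs_dist_def k W_def power2_norm_eq_inner inner_add_left inner_add_right inner_commute)
  qed
  have "fst x - inversion (fst x + d) k y = - (d + (k / W) *\<^sub>R w)"
    by (simp add: inversion_def w_def W_def)
  then have "(norm (fst x - inversion (fst x + d) k y))\<^sup>2 = (norm (d + (k / W) *\<^sub>R w))\<^sup>2"
    by (simp only: norm_minus_cancel)
  also have "\<dots> = (norm d)\<^sup>2 + 2 * (k / W) * (w \<bullet> d) + (k / W)\<^sup>2 * W"
    unfolding W_def power2_norm_eq_inner
    by (simp add: inner_add_left inner_add_right inner_commute power2_eq_square)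
  also have "(k / W)\<^sup>2 * W = k * k / W"
    by (simp add: power2_eq_square)
  finally have "hs_dist x (inversion (fst x + d) k y) = k + 2 * (k / W) * (w \<bullet> d) + k * k / W"
    by (simp add: hs_dist_def k)
  then have "hs_dist x (inversion (fst x + d) k y) * W = k * (W + 2 * (w \<bullet> d) + k)"
    using W by (simp add: field_simps)
  then show ?thesis
    by (simp add: 1 W_def w_def)
qed

text \<open>The conformal factor to the power n - 1 is the Jacobian, so this says that the inversion
  preserves the measure with density \<open>hs_kernel x\<close>.\<close>

lemma hs_kernel_inversion:
  fixes y :: "'a::euclidean_space"
  assumes x: "0 < snd x" and y: "y \<noteq> fst x + d" and k: "k = (norm d)\<^sup>2 + (snd x)\<^sup>2"
  shows "\<bar>k / (norm (y - (fst x + d)))\<^sup>2\<bar> ^ DIM('a) * hs_kernel x (inversion (fst x + d) k y) = hs_kernel x y"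
proof -
  have k0: "0 < k" using x by (simp add: k add_nonneg_pos)
  have "(norm (y - (fst x + d)))\<^sup>2 \<noteq> 0" using y by simp
  then have "k / (norm (y - (fst x + d)))\<^sup>2 * (snd x / hs_dist x (inversion (fst x + d) k y)) = snd x / hs_dist x y"
    using hs_dist_inversion[OF y k] hs_dist_pos[OF x, of y] hs_dist_pos[OF x, of "inversion (fst x + d) k y"] k0
    by (simp add: field_simps)
  then show ?thesis
    using k0 by (simp add: hs_kernel_def flip: power_mult_distrib)
qed

text \<open>The inversion of the whole space fixes x, and its differential there is the reflection
  along \<open>(- d, snd x)\<close>, the vector from the centre to x. Preserving the kernel, it
  moves gradient directions at x by that reflection; the proof checks this by components.\<close>

lemma hs_dir_inversion:
  assumes x: "0 < snd x" and y: "y \<noteq> fst x + d" and k: "k = (norm d)\<^sup>2 + (snd x)\<^sup>2"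
  shows "hs_dir x (inversion (fst x + d) k y) = reflect (- d, snd x) (hs_dir x y)"
proof -
  define w where "w = y - (fst x + d)"
  define W where "W = (norm w)\<^sup>2"
  let ?D = "hs_dist x y" and ?t = "snd x"
  have W: "W \<noteq> 0" using y by (simp add: w_def W_def)
  have k0: "k \<noteq> 0" using x by (simp add: k add_nonneg_eq_0_iff)
  have D: "?D \<noteq> 0" using hs_dist_pos[OF x, of y] by simp
  have u: "y - fst x = w + d" by (simp add: w_def)
  have D_eq: "?D = W + 2 * (w \<bullet> d) + k"
  proof -
    have "(norm (fst x - y))\<^sup>2 = (norm (w + d))\<^sup>2" by (simp only: norm_minus_commute[of "fst x"] u)
    then show ?thesis
      by (simp add: hs_dist_def k W_def power2_norm_eq_inner inner_add_left inner_add_right inner_commute)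
  qed
  have D': "hs_dist x (inversion (fst x + d) k y) = k * ?D / W"
    using hs_dist_inversion[OF y k] W by (simp add: W_def w_def field_simps)
  have "hs_dir x y \<bullet> (- d, ?t) = (?t / ?D) * (?D - 2 * (w \<bullet> d) - 2 * k)"
    using D by (simp add: hs_dir_def u inner_add_left k dot_square_norm field_simps power2_eq_square)
  then have inner: "hs_dir x y \<bullet> (- d, ?t) = (?t / ?D) * (W - k)"
    by (simp add: D_eq)
  have vv: "(- d, ?t) \<bullet> (- d, ?t) = k"
    by (simp add: k dot_square_norm[of d, symmetric] power2_eq_square[of "snd x"])
  have i: "inversion (fst x + d) k y - fst x = d + (k / W) *\<^sub>R w"
    by (simp add: inversion_def w_def W_def)
  \<comment> \<open>The coefficient in the reflection: twice the inner product with
    \<open>(- d, snd x)\<close>, over its squared length k.\<close>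
  let ?c = "2 * (?t / ?D * (W - k)) / k"
  have "(2 * ?t / (k * ?D / W)) *\<^sub>R (d + (k / W) *\<^sub>R w) = (2 * ?t / ?D) *\<^sub>R (w + d) + ?c *\<^sub>R d"
  proof -
    have 1: "2 * ?t / (k * ?D / W) * (k / W) = 2 * ?t / ?D"
      using W k0 by simp
    have 2: "2 * ?t / (k * ?D / W) = 2 * ?t / ?D + ?c"
      using W k0 D by (simp add: field_simps)
    have "(2 * ?t / (k * ?D / W)) *\<^sub>R (d + (k / W) *\<^sub>R w) = (2 * ?t / (k * ?D / W)) *\<^sub>R d + (2 * ?t / ?D) *\<^sub>R w"
      by (simp only: scaleR_add_right scaleR_scaleR 1)
    then show ?thesis
      unfolding 2 by (simp only: scaleR_add_left scaleR_add_right ac_simps)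
  qed
  moreover have "1 - 2 * ?t\<^sup>2 / (k * ?D / W) = 1 - 2 * ?t\<^sup>2 / ?D - ?c * ?t"
    using W k0 D by (simp add: field_simps power2_eq_square)
  ultimately show ?thesis
    unfolding reflect_def inner vv unfolding hs_dir_def D' i u by simp
qed

lemma hs_kernel_le: "0 < snd x \<Longrightarrow> hs_kernel x y \<le> (1 / snd x) ^ DIM('a)" for y :: "'a::euclidean_space"
  unfolding hs_kernel_def using hs_dist_pos[of x y]
  by (intro power_mono) (auto simp: divide_simps hs_dist_def power2_eq_square)

text \<open>The inversion of centre \<^term>\<open>fst x\<close> that fixes the kernel measure exchanges a bounded ball with its exterior.\<close>

lemma integrable_hs_kernel:
  fixes x :: "'a::euclidean_space \<times> real"
  assumes x: "0 < snd x"
  shows "integrable lborel (hs_kernel x)"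
proof -
  define p where "p = fst x"
  define t where "t = snd x"
  have t: "0 < t" using x by (simp add: t_def)
  let ?g = "inversion p (t\<^sup>2)"
  let ?S = "- cball p t" and ?T = "ball p t - {p}"
  have p: "p = fst x + 0" by (simp add: p_def)
  have img: "?g ` ?S = ?T"
  proof (intro equalityI subsetI)
    fix y assume "y \<in> ?g ` ?S"
    then obtain z where z: "y = ?g z" "t < norm (z - p)" by (auto simp: dist_norm norm_minus_commute)
    then have "z \<noteq> p" using t by auto
    moreover have "norm (y - p) < t"
      using z t norm_inversion_minus_center[of p "t\<^sup>2" z] by (simp add: power2_eq_square divide_less_eq)
    ultimately show "y \<in> ?T"
      using inversion_neq_center[of z p "t\<^sup>2"] t z(1) by (auto simp: dist_norm norm_minus_commute)
  next
    fix y assume y: "y \<in> ?T"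
    then have "y \<noteq> p" "norm (y - p) < t" by (auto simp: dist_norm norm_minus_commute)
    then have "t < norm (?g y - p)"
      using t by (simp add: norm_inversion_minus_center power2_eq_square less_divide_eq)
    then have "?g y \<in> ?S" by (auto simp: dist_norm norm_minus_commute)
    then show "y \<in> ?g ` ?S"
      using inversion_inversion[of y p "t\<^sup>2"] y t by (intro image_eqI[of _ _ "?g y"]) auto
  qed
  have bounded_int: "set_integrable lborel A (hs_kernel x)" if "A \<subseteq> cball p t" "A \<in> sets borel" for A
  proof -
    have "emeasure lborel A < \<infinity>"
      using emeasure_mono[OF that(1), of lborel] emeasure_lborel_cball_finite[of p t] by (simp add: order_le_less_trans)
    then show ?thesis
      unfolding set_integrable_def
      using that hs_kernel_le[OF x] hs_kernel_nonneg[OF x]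
      by (intro integrableI_bounded_set_indicator[where B = "(1 / snd x) ^ DIM('a)"]) auto
  qed
  let ?a = "\<lambda>y. t\<^sup>2 / (norm (y - p))\<^sup>2"
  have "set_integrable lborel ?S (\<lambda>y. \<bar>?a y\<bar> ^ DIM('a) * hs_kernel x (?g y)) \<longleftrightarrow> set_integrable lborel ?T (hs_kernel x)"
  proof (rule change_of_variables_conformal(1)[where Q = "\<lambda>y. reflect (y - p)"])
    show "inj_on ?g ?S"
      using t by (intro inj_on_subset[OF inversion_bij(2)]) auto
    show "(?g has_derivative (\<lambda>h. ?a y *\<^sub>R reflect (y - p) h)) (at y)" if "y \<in> ?S" for y
      using that t by (intro has_derivative_inversion) auto
  qed (use img in \<open>auto simp: orthogonal_transformation_reflect\<close>)
  moreover have "\<bar>?a y\<bar> ^ DIM('a) * hs_kernel x (?g y) = hs_kernel x y" if "y \<in> ?S" for y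
    using that t hs_kernel_inversion[OF x, of y 0] by (force simp: p_def t_def)
  then have "set_integrable lborel ?S (\<lambda>y. \<bar>?a y\<bar> ^ DIM('a) * hs_kernel x (?g y)) \<longleftrightarrow> set_integrable lborel ?S (hs_kernel x)"
    by (intro set_integrable_cong) auto
  moreover have "set_integrable lborel ?T (hs_kernel x)"
    using ball_subset_cball[of p t] by (intro bounded_int) auto
  ultimately have "set_integrable lborel ?S (hs_kernel x)"
    by simp
  then have "set_integrable lborel (cball p t \<union> ?S) (hs_kernel x)"
    using bounded_int[of "cball p t"] by (intro set_integrable_Un) auto
  then show ?thesis
    by (simp add: set_integrable_def Compl_partition)
qed

text \<open>The factor \<open>poisson_halfspace_const\<close> is kept out of this measure and enters
  through \<open>hs_grad\<close>.\<close>

definition hs_measure :: "'a::euclidean_space \<times> real \<Rightarrow> ('a \<times> real) measure" where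
  "hs_measure x = distr (density lborel (hs_kernel x)) borel (hs_dir x)"

lemma finite_measure_hs_measure:
  assumes x: "0 < snd x" shows "finite_measure (hs_measure x)"
proof -
  have "emeasure (density lborel (hs_kernel x)) (space lborel) < \<infinity>"
    using integrable_hs_kernel[OF x] hs_kernel_nonneg[OF x]
    by (simp add: emeasure_density nn_integral_eq_integral)
  then have "finite_measure (density lborel (hs_kernel x))"
    by (intro finite_measureI) simp
  then show ?thesis
    unfolding hs_measure_def by (rule finite_measure.finite_measure_distr) simp
qed

lemma AE_norm_hs_measure: "0 < snd x \<Longrightarrow> AE z in hs_measure x. norm z = 1"
  unfolding hs_measure_def by (subst AE_distr_iff) (simp_all add: norm_hs_dir)

lemma integral_hs_measure:
  fixes f :: "'a::euclidean_space \<times> real \<Rightarrow> real"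
  assumes "0 < snd x" "f \<in> borel_measurable borel"
  shows "(\<integral>z. f z \<partial>hs_measure x) = (\<integral>y. hs_kernel x y * f (hs_dir x y) \<partial>lborel)"
  unfolding hs_measure_def using assms
  by (subst integral_distr) (simp_all add: integral_density hs_kernel_nonneg)

text \<open>Every reflection lifts to a boundary map preserving the kernel measure: a horizontal one
  to a reflection about \<open>fst x\<close>, any other to an inversion.\<close>

lemma reflect_hs_measure:
  fixes x :: "'a::euclidean_space \<times> real"
  assumes x: "0 < snd x"
  shows "distr (hs_measure x) borel (reflect v) = hs_measure x"
proof (cases "snd v = 0")
  case True
  define v1 where "v1 = fst v"
  let ?g = "\<lambda>y. fst x + reflect v1 (y - fst x)"
  have inv: "?g (?g y) = y" for y by (simp add: reflect_reflect)
  have refl: "reflect v (a, b) = (reflect v1 a, b)" for a b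
    using True by (cases v) (simp add: reflect_def v1_def)
  have dist: "hs_dist x (?g y) = hs_dist x y" for y
    by (simp add: hs_dist_def norm_reflect norm_minus_commute)
  have kernel: "hs_kernel x (?g y) = hs_kernel x y" for y
    by (simp add: hs_kernel_def dist)
  have surj: "?g ` UNIV = UNIV" by (rule surjI[where f = ?g, OF inv])
  have inj: "inj ?g" by (rule inj_on_inverseI[where g = ?g, OF inv])
  show ?thesis
    unfolding hs_measure_def
  proof (rule distr_density_reflect[where S = UNIV and g = ?g and a = "\<lambda>_. 1" and Q = "\<lambda>_. reflect v1"])
    show "(?g has_derivative (\<lambda>h. 1 *\<^sub>R reflect v1 h)) (at y)" for y
    proof -
      have "bounded_linear (reflect v1)"
        by (metis linear_conv_bounded_linear orthogonal_transformation_linear orthogonal_transformation_reflect)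
      moreover have "((\<lambda>y. y - fst x) has_derivative (\<lambda>h. h)) (at y)"
        by (auto intro!: derivative_eq_intros)
      ultimately have "((\<lambda>y. reflect v1 (y - fst x)) has_derivative (\<lambda>h. reflect v1 h)) (at y)"
        by (rule bounded_linear.has_derivative)
      from has_derivative_add[OF has_derivative_const this] show ?thesis
        by simp
    qed
    show "hs_dir x (?g y) = reflect v (hs_dir x y)" for y
      unfolding hs_dir_def dist refl by (simp add: reflect_scaleR)
  qed (use x in \<open>simp_all add: integrable_hs_kernel hs_kernel_nonneg surj inj orthogonal_transformation_reflect kernel\<close>)
next
  case False
  \<comment> \<open>The centre \<open>fst x + d\<close> is the point where the line through x in
    direction v meets the boundary, which makes v parallel to \<open>(- d, snd x)\<close>.\<close>
  define d where "d = - (snd x / snd v) *\<^sub>R fst v"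
  define k where "k = (norm d)\<^sup>2 + (snd x)\<^sup>2"
  let ?c = "fst x + d"
  have k0: "k \<noteq> 0" using x by (simp add: k_def add_nonneg_eq_0_iff)
  have "v = (snd v / snd x) *\<^sub>R (- d, snd x)"
    using False x by (simp add: d_def prod_eq_iff)
  then have refl: "reflect v = reflect (- d, snd x)"
    using reflect_scaleR_axis[of "snd v / snd x" "(- d, snd x)"] False x by simp
  show ?thesis
    unfolding hs_measure_def refl
  proof (rule distr_density_reflect[where S = "- {?c}" and g = "inversion ?c k" and
        a = "\<lambda>y. k / (norm (y - ?c))\<^sup>2" and Q = "\<lambda>y. reflect (y - ?c)"])
    show "AE y in lborel. y \<in> - {?c}"
      using AE_lborel_singleton[of ?c] by simp
    show "(inversion ?c k has_derivative (\<lambda>h. (k / (norm (y - ?c))\<^sup>2) *\<^sub>R reflect (y - ?c) h)) (at y)"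
      if "y \<in> - {?c}" for y
      using that by (intro has_derivative_inversion) simp
    show "\<bar>k / (norm (y - ?c))\<^sup>2\<bar> ^ DIM('a) * hs_kernel x (inversion ?c k y) = hs_kernel x y" if "y \<in> - {?c}" for y
      using that by (intro hs_kernel_inversion[OF x _ k_def]) simp
    show "hs_dir x (inversion ?c k y) = reflect (- d, snd x) (hs_dir x y)" if "y \<in> - {?c}" for y
      using that by (intro hs_dir_inversion[OF x _ k_def]) simp
  qed (use x in \<open>simp_all add: integrable_hs_kernel hs_kernel_nonneg inversion_bij k0 orthogonal_transformation_reflect\<close>)
qed

lemma hs_kernel_pos: "0 < snd x \<Longrightarrow> 0 < hs_kernel x y"
  using hs_dist_pos[of x y] by (simp add: hs_kernel_def)

text \<open>One factor of the kernel stays as density. The base of the rest,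
  \<open>snd x / hs_dist x y\<close>, is affine in the height of \<open>hs_dir x y\<close>, which
  gives both the weight and the constant.\<close>

lemma hs_kernel_powr:
  fixes y :: "'a::euclidean_space" and q :: real
  assumes x: "0 < snd x"
  shows "hs_kernel x y powr q =
    (1 / (2 * snd x)) powr (DIM('a) * (q - 1)) *
    (hs_kernel x y * (1 - snd (hs_dir x y)) powr (DIM('a) * (q - 1)))"
proof -
  let ?r = "snd x / hs_dist x y"
  have D: "0 < hs_dist x y" by (rule hs_dist_pos[OF x])
  have r: "0 < ?r" using x D by simp
  have "hs_kernel x y powr q = hs_kernel x y powr 1 * hs_kernel x y powr (q - 1)"
    by (subst powr_add[symmetric]) simp
  also have "\<dots> = hs_kernel x y * ?r powr (DIM('a) * (q - 1))"
    using hs_kernel_pos[OF x, of y] r by (simp add: hs_kernel_def powr_powr flip: powr_realpow)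
  also have "?r = 1 / (2 * snd x) * (1 - snd (hs_dir x y))"
    using x by (simp add: hs_dir_def power2_eq_square)
  also have "\<dots> powr (DIM('a) * (q - 1)) =
      (1 / (2 * snd x)) powr (DIM('a) * (q - 1)) * (1 - snd (hs_dir x y)) powr (DIM('a) * (q - 1))"
    by (rule powr_mult)
  finally show ?thesis by simp
qed

section \<open>Differentiating the Poisson integral of the half-space\<close>

lemma integrable_hs_kernel_powr:
  fixes x :: "'a::euclidean_space \<times> real" and q :: real
  assumes x: "0 < snd x" and q: "1 < q"
  shows "integrable lborel (\<lambda>y. hs_kernel x y powr q)"
proof (rule Bochner_Integration.integrable_bound)
  let ?C = "((1 / snd x) ^ DIM('a)) powr (q - 1)"
  show "integrable lborel (\<lambda>y. hs_kernel x y * ?C)"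
    using integrable_hs_kernel[OF x] by simp
  have "hs_kernel x y powr q \<le> hs_kernel x y * ?C" for y
  proof -
    have "hs_kernel x y powr q = hs_kernel x y powr 1 * hs_kernel x y powr (q - 1)"
      by (subst powr_add[symmetric]) simp
    also have "\<dots> \<le> hs_kernel x y powr 1 * ?C"
      using q hs_kernel_nonneg[OF x, of y] hs_kernel_le[OF x, of y] by (intro mult_left_mono powr_mono2) auto
    finally show ?thesis
      using hs_kernel_nonneg[OF x, of y] by simp
  qed
  then show "AE y in lborel. norm (hs_kernel x y powr q) \<le> norm (hs_kernel x y * ?C)"
    using hs_kernel_nonneg[OF x] by (intro AE_I2) simp
qed simp

text \<open>Supplies a dominating function near x. In this ball the height is at most 3/2 of
  \<open>snd x\<close>, and \<open>hs_dist x y\<close> is at most 6 times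
  \<open>hs_dist z y\<close>; 9 is the product.\<close>

lemma hs_kernel_Harnack:
  fixes y :: "'a::euclidean_space"
  assumes x: "0 < snd x" and z: "z \<in> ball x (snd x / 2)"
  shows "snd x / 2 < snd z" "hs_kernel z y \<le> 9 ^ DIM('a) * hs_kernel x y"
proof -
  let ?t = "snd x" and ?s = "snd z"
  have d1: "norm (fst z - fst x) < ?t / 2" and d2: "\<bar>?s - ?t\<bar> < ?t / 2"
    using z norm_fst_le[of "fst x - fst z" "snd x - snd z"] norm_snd_le[of "snd x - snd z" "fst x - fst z"]
    by (auto simp: dist_norm norm_minus_commute minus_prod_def abs_minus_commute)
  then show s: "?t / 2 < ?s" by linarith
  have s': "?s \<le> 3 / 2 * ?t" using d2 by linarith
  have "norm (fst x - y) \<le> ?t / 2 + norm (fst z - y)"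
    using norm_triangle_ineq[of "fst x - fst z" "fst z - y"] d1 by (simp add: norm_minus_commute)
  then have "(norm (fst x - y))\<^sup>2 \<le> (?t / 2 + norm (fst z - y))\<^sup>2"
    by (rule power_mono) simp
  also have "\<dots> \<le> 2 * (?t / 2)\<^sup>2 + 2 * (norm (fst z - y))\<^sup>2"
    using zero_le_power2[of "?t / 2 - norm (fst z - y)"] by (simp add: power2_sum power2_diff)
  finally have "hs_dist x y \<le> 2 * (norm (fst z - y))\<^sup>2 + 6 * (?t / 2)\<^sup>2"
    by (simp add: hs_dist_def power2_eq_square)
  also have "\<dots> \<le> 6 * hs_dist z y"
  proof -
    have s2: "(?t / 2)\<^sup>2 \<le> ?s\<^sup>2"
      using s x by (intro power_mono) auto
    have "2 * a + 6 * b \<le> 6 * (a + c)" if "b \<le> c" "0 \<le> a" for a b c :: real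
      using that mult_left_mono[OF that(1), of 6] by (simp add: distrib_left)
    from this[OF s2 zero_le_power2] show ?thesis
      unfolding hs_dist_def .
  qed
  finally have D: "hs_dist x y \<le> 6 * hs_dist z y" .
  have pos: "0 < hs_dist x y" "0 < hs_dist z y" using x s by (auto intro!: hs_dist_pos)
  have "?s * hs_dist x y \<le> (3 / 2 * ?t) * (6 * hs_dist z y)"
    using s s' D pos x by (intro mult_mono) auto
  then have "?s / hs_dist z y \<le> 9 * (?t / hs_dist x y)"
    using pos by (simp add: field_simps)
  then have "(?s / hs_dist z y) ^ DIM('a) \<le> (9 * (?t / hs_dist x y)) ^ DIM('a)"
    using s x pos by (intro power_mono) auto
  then show "hs_kernel z y \<le> 9 ^ DIM('a) * hs_kernel x y"
    by (simp only: hs_kernel_def power_mult_distrib)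
qed

definition hs_grad :: "'a::euclidean_space \<times> real \<Rightarrow> 'a \<Rightarrow> 'a \<times> real" where
  "hs_grad z y = (poisson_halfspace_const DIM('a \<times> real) * DIM('a) * hs_kernel z y / snd z) *\<^sub>R hs_dir z y"

lemma norm_hs_grad:
  fixes y :: "'a::euclidean_space"
  assumes "0 < snd z"
  shows "norm (hs_grad z y) = \<bar>poisson_halfspace_const DIM('a \<times> real)\<bar> * DIM('a) / snd z * hs_kernel z y"
  using assms hs_kernel_nonneg[OF assms, of y] by (simp add: hs_grad_def norm_hs_dir abs_mult)

text \<open>By the Harnack bound a multiple of the kernel at x dominates all gradients nearby; that
  kernel lies in L^q, hence is integrable against \<phi>.\<close>

lemma gradient_poisson_halfspace:
  fixes x :: "'a::euclidean_space \<times> real" and q :: real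
  assumes x: "0 < snd x" and q: "1 < q" and \<phi>: "\<phi> \<in> Lp_space lborel (conj_exp q)"
  shows "gradient (poisson_halfspace \<phi>) x = (\<integral>y. \<phi> y *\<^sub>R hs_grad x y \<partial>lborel)"
proof (rule gradient_eqI)
  let ?c = "poisson_halfspace_const DIM('a \<times> real)"
  have [measurable]: "\<phi> \<in> borel_measurable borel" using \<phi> by (simp add: Lp_space_def)
  have "poisson_halfspace \<phi> = (\<lambda>z. \<integral>y. ?c * hs_kernel z y * \<phi> y \<partial>lborel)"
    by (simp add: poisson_halfspace_def hs_kernel_def hs_dist_def fun_eq_iff mult.assoc)
  moreover have "GDERIV (\<lambda>z. \<integral>y. ?c * hs_kernel z y * \<phi> y \<partial>lborel) x :> (\<integral>y. \<phi> y *\<^sub>R hs_grad x y \<partial>lborel)"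
  proof (rule GDERIV_integral[where r = "snd x / 2" and
        B = "\<lambda>y. \<bar>?c\<bar> * DIM('a) / (snd x / 2) * (9 ^ DIM('a) * hs_kernel x y)"])
    fix z y assume "z \<in> ball x (snd x / 2)"
    note H = hs_kernel_Harnack[OF x this]
    have z: "0 < snd z" using H(1) x by simp
    show "GDERIV (\<lambda>z. ?c * hs_kernel z y) z :> hs_grad z y"
    proof -
      have "DERIV (\<lambda>r. ?c * r) (hs_kernel z y) :> ?c"
        by (auto intro!: derivative_eq_intros)
      from GDERIV_DERIV_compose[OF GDERIV_hs_kernel[OF z] this] show ?thesis
        by (simp add: hs_grad_def mult.assoc)
    qed
    show "norm (hs_grad z y) \<le> \<bar>?c\<bar> * DIM('a) / (snd x / 2) * (9 ^ DIM('a) * hs_kernel x y)"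
      unfolding norm_hs_grad[OF z]
      using H(1) H(2)[of y] x hs_kernel_nonneg[OF z, of y] by (intro mult_mono divide_left_mono) auto
  next
    have "hs_kernel x \<in> Lp_space lborel q"
      using integrable_hs_kernel_powr[OF x q] hs_kernel_nonneg[OF x] by (intro Lp_spaceI) simp_all
    from Lp_mult_integrable[OF q \<phi> this]
    have int: "integrable lborel (\<lambda>y. k * (\<phi> y * hs_kernel x y))" for k
      by simp
    show "integrable lborel (\<lambda>y. \<bar>?c\<bar> * DIM('a) / (snd x / 2) * (9 ^ DIM('a) * hs_kernel x y) * \<phi> y)"
      using int[of "\<bar>?c\<bar> * DIM('a) / (snd x / 2) * 9 ^ DIM('a)"] by (simp only: ac_simps)
    show "integrable lborel (\<lambda>y. ?c * hs_kernel x y * \<phi> y)"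
      using int[of ?c] by (simp only: ac_simps)
  qed (use x in \<open>simp_all add: hs_grad_def\<close>)
  ultimately show "GDERIV (poisson_halfspace \<phi>) x :> (\<integral>y. \<phi> y *\<^sub>R hs_grad x y \<partial>lborel)"
    by simp
qed

text \<open>The values A = 1 and B = -1 encode the weight of \<open>hs_kernel_powr\<close>; k
  collects the ratio of gradient length to kernel and the constant of that lemma.\<close>

lemma C_halfspace_extremal:
  fixes x l t :: "'a::euclidean_space \<times> real" and q :: real
  assumes q: "1 < q" "DIM('a) * (q - 1) \<le> 1" and x: "0 < snd x"
    and l: "norm l = 1" and t: "norm t = 1" "t \<bullet> (0, 1) = 0"
  shows "C_halfspace_dir q x (0, 1) \<le> C_halfspace_dir q x l \<and>
    C_halfspace_dir q x (- (0, 1)) \<le> C_halfspace_dir q x l \<and>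
    C_halfspace_dir q x l \<le> C_halfspace_dir q x t \<and>
    C_halfspace_dir q x t = C_halfspace q x"
  unfolding C_halfspace_dir_def C_halfspace_def
proof (rule grad_const_extremal[where H = "hs_grad x" and N = "hs_measure x" and A = 1 and B = "-1" and
      a = "DIM('a) * (q - 1)" and S = "ball 0 1" and
      k = "(\<bar>poisson_halfspace_const DIM('a \<times> real)\<bar> * DIM('a) / snd x) powr q * (1 / (2 * snd x)) powr (DIM('a) * (q - 1))"])
  let ?a = "DIM('a) * (q - 1)"
  let ?C = "\<bar>poisson_halfspace_const DIM('a \<times> real)\<bar> * DIM('a) / snd x"
  show "hs_grad x \<in> borel_measurable lborel"
    unfolding hs_grad_def by measurable
  show "integrable lborel (\<lambda>y. norm (hs_grad x y) powr q)"
    unfolding norm_hs_grad[OF x] powr_mult using integrable_hs_kernel_powr[OF x q(1)] by simp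
  show "0 < measure lborel (ball (0 :: 'a) 1)"
    by (simp add: content_ball_pos)
  show "(\<integral>y. \<bar>hs_grad x y \<bullet> l\<bar> powr q \<partial>lborel) =
      ?C powr q * (1 / (2 * snd x)) powr ?a * (\<integral>z. (1 + -1 * (z \<bullet> (0, 1))) powr ?a * \<bar>z \<bullet> l\<bar> powr q \<partial>hs_measure x)" for l
  proof -
    have "\<bar>hs_grad x y \<bullet> l\<bar> powr q = ?C powr q * (1 / (2 * snd x)) powr ?a *
        (hs_kernel x y * ((1 + -1 * (hs_dir x y \<bullet> (0, 1))) powr ?a * \<bar>hs_dir x y \<bullet> l\<bar> powr q))" for y
    proof -
      have "\<bar>hs_grad x y \<bullet> l\<bar> = ?C * hs_kernel x y * \<bar>hs_dir x y \<bullet> l\<bar>"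
        using x hs_kernel_nonneg[OF x, of y] by (simp add: hs_grad_def abs_mult)
      moreover have "1 + -1 * (hs_dir x y \<bullet> (0, 1)) = 1 - snd (hs_dir x y)"
        by (simp add: inner_prod_def)
      ultimately show ?thesis
        by (simp only: powr_mult hs_kernel_powr[OF x] ac_simps)
    qed
    then show ?thesis
      by (subst integral_hs_measure[OF x]) simp_all
  qed
qed (use q x l t in \<open>simp_all add: gradient_poisson_halfspace finite_measure_hs_measure AE_norm_hs_measure
    reflect_hs_measure, simp_all add: hs_measure_def\<close>)

section \<open>The ball\<close>

text \<open>The uniform distribution on the ball as an explicit real density, the form in which
  Lebesgue changes of variables apply.\<close>

definition ball_density :: "'a::euclidean_space \<Rightarrow> real" where
  "ball_density x = indicator (ball 0 1) x / measure lborel (ball (0::'a) 1)"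

text \<open>This is \<open>sphere_measure\<close> before restriction to the sphere: as a measure on
  all Borel sets it can be mapped by \<open>reflect\<close> and fits the rearrangement
  lemma.\<close>

definition radial_measure :: "'a::euclidean_space measure" where
  "radial_measure = distr (density lborel ball_density) borel (\<lambda>x. x /\<^sub>R norm x)"

lemma ball_density_nonneg: "0 \<le> ball_density x"
  by (simp add: ball_density_def)

lemma measurable_ball_density [measurable]: "ball_density \<in> borel_measurable borel"
  unfolding ball_density_def by (intro borel_measurable_divide borel_measurable_indicator borel_measurable_const) simp

lemma integrable_ball_density: "integrable lborel (ball_density :: 'a::euclidean_space \<Rightarrow> real)"
  unfolding ball_density_def using emeasure_lborel_ball_finite[of "0 :: 'a" 1]
  by (intro Bochner_Integration.integrable_divide_zero) simp

lemma sphere_measure_eq: "sphere_measure = restrict_space radial_measure (sphere (0 :: 'a::euclidean_space) 1)"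
proof -
  have "emeasure lborel (ball (0 :: 'a) 1) = ennreal (measure lborel (ball (0 :: 'a) 1))"
    using emeasure_lborel_ball_finite[of "0 :: 'a" 1] by (simp add: emeasure_eq_ennreal_measure)
  then have "uniform_measure lborel (ball (0 :: 'a) 1) = density lborel ball_density"
    unfolding uniform_measure_def ball_density_def
    by (intro density_cong) (auto simp: divide_ennreal content_ball_pos indicator_def zero_less_measure_iff
        simp flip: ennreal_1)
  then show ?thesis
    by (simp add: sphere_measure_def radial_measure_def)
qed

lemma sets_radial_measure [measurable_cong]: "sets radial_measure = sets borel"
  by (simp add: radial_measure_def)

lemma AE_norm_radial_measure: "AE z in (radial_measure :: 'a::euclidean_space measure). norm z = 1"
proof -
  have "AE x in lborel. x \<noteq> (0 :: 'a)"
    by (rule AE_lborel_singleton)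
  then show ?thesis
    unfolding radial_measure_def by (subst AE_distr_iff) (auto simp: AE_density)
qed

lemma finite_measure_radial_measure: "finite_measure (radial_measure :: 'a::euclidean_space measure)"
proof -
  have "emeasure (density lborel (ball_density :: 'a \<Rightarrow> real)) (space lborel) < \<infinity>"
    using integrable_ball_density[where 'a='a]
    by (simp add: emeasure_density nn_integral_eq_integral ball_density_nonneg)
  then have "finite_measure (density lborel (ball_density :: 'a \<Rightarrow> real))"
    by (intro finite_measureI) simp
  then show ?thesis
    unfolding radial_measure_def by (rule finite_measure.finite_measure_distr) simp
qed

text \<open>Reflections preserve Lebesgue measure and the unit ball, and commute with radial
  projection.\<close>

lemma reflect_radial_measure:
  fixes v :: "'a::euclidean_space"
  shows "distr radial_measure borel (reflect v) = radial_measure"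
  unfolding radial_measure_def
proof (rule distr_density_reflect[where S = UNIV and g = "reflect v" and a = "\<lambda>_. 1" and Q = "\<lambda>_. reflect v"])
  have bl: "bounded_linear (reflect v)"
    by (metis linear_conv_bounded_linear orthogonal_transformation_linear orthogonal_transformation_reflect)
  show "(reflect v has_derivative (\<lambda>h. 1 *\<^sub>R reflect v h)) (at y)" for y
    using bounded_linear_imp_has_derivative[OF bl] by simp
  show "\<bar>1\<bar> ^ DIM('a) * ball_density (reflect v y) = ball_density y" for y
    by (simp add: ball_density_def norm_reflect indicator_def)
  show "inj (reflect v)"
    by (rule inj_on_inverseI[where g = "reflect v"]) (rule reflect_reflect)
  show "range (reflect v) = UNIV"
    by (rule surjI[where f = "reflect v"]) (rule reflect_reflect)
qed (simp_all add: integrable_ball_density ball_density_nonneg orthogonal_transformation_reflect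
    norm_reflect reflect_scaleR)

text \<open>The centre is removed because the cone map used later need not be differentiable
  there.\<close>

lemma integral_radial_measure:
  fixes f :: "'a::euclidean_space \<Rightarrow> real"
  assumes [measurable]: "f \<in> borel_measurable borel"
  shows "(\<integral>z. f z \<partial>radial_measure) =
    (LINT y:ball 0 1 - {0}|lborel. f (y /\<^sub>R norm y)) / measure lborel (ball (0 :: 'a) 1)"
proof -
  have "(\<integral>z. f z \<partial>radial_measure) = (\<integral>y. ball_density y * f (y /\<^sub>R norm y) \<partial>lborel)"
    unfolding radial_measure_def by (subst integral_distr) (simp_all add: integral_density ball_density_nonneg)
  also have "\<dots> = (LINT y:- {0}|lborel. ball_density y * f (y /\<^sub>R norm y))"
    using AE_lborel_singleton[of "0 :: 'a"] by (intro set_integral_AE[symmetric]) auto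
  also have "\<dots> = (LINT y:ball 0 1 - {0}|lborel. f (y /\<^sub>R norm y)) / measure lborel (ball (0 :: 'a) 1)"
    unfolding set_lebesgue_integral_def integral_divide_zero[symmetric]
    by (intro Bochner_Integration.integral_cong) (auto simp: ball_density_def indicator_def)
  finally show ?thesis .
qed

lemma measurable_sphere_measure: "f \<in> measurable borel M \<Longrightarrow> f \<in> measurable sphere_measure M"
  unfolding sphere_measure_eq by (intro measurable_restrict_space1) measurable

lemma space_sphere_measure: "space sphere_measure = sphere 0 1"
  by (simp add: sphere_measure_eq space_restrict_space radial_measure_def)

lemma finite_measure_sphere_measure: "finite_measure sphere_measure"
  unfolding sphere_measure_eq
  by (rule finite_measure_restrict_space[OF finite_measure_radial_measure]) (simp add: radial_measure_def)

lemma integral_sphere_measure: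
  fixes f :: "'a::euclidean_space \<Rightarrow> real"
  assumes [measurable]: "f \<in> borel_measurable borel"
  shows "(\<integral>z. f z \<partial>sphere_measure) = (\<integral>z. f z \<partial>radial_measure)"
proof -
  have "(\<integral>z. f z \<partial>sphere_measure) = (LINT z:sphere 0 1|radial_measure. f z)"
    unfolding sphere_measure_eq set_lebesgue_integral_def
    by (rule integral_restrict_space) (simp add: radial_measure_def)
  also have "\<dots> = (\<integral>z. f z \<partial>radial_measure)"
    using AE_norm_radial_measure by (intro set_integral_AE) auto
  finally show ?thesis .
qed

lemma measure_sphere_measure_pos: "0 < measure sphere_measure (sphere (0 :: 'a::euclidean_space) 1)"
proof -
  have pos: "0 < measure lborel (ball (0 :: 'a) 1)" by (simp add: content_ball_pos)
  have "measure sphere_measure (sphere (0 :: 'a) 1) = (\<integral>z. 1 \<partial>(sphere_measure :: 'a measure))"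
    using space_sphere_measure[where 'a='a] by simp
  also have "\<dots> = (LINT y:ball (0 :: 'a) 1 - {0}|lborel. 1) / measure lborel (ball (0 :: 'a) 1)"
    by (subst integral_sphere_measure, simp, subst integral_radial_measure) simp_all
  also have "(LINT y:ball (0 :: 'a) 1 - {0}|lborel. 1) = measure lborel (ball (0 :: 'a) 1 - {0})"
    by (simp add: set_lebesgue_integral_def)
  also have "\<dots> = measure lborel (ball (0 :: 'a) 1)"
    using emeasure_lborel_ball_finite[of "0 :: 'a" 1] by (subst measure_Diff) simp_all
  finally show ?thesis using pos by simp
qed

section \<open>The kernel of the ball and its boundary map\<close>

definition ball_factor :: "'a::euclidean_space \<Rightarrow> 'a \<Rightarrow> real" where
  "ball_factor x \<zeta> = (1 - (norm x)\<^sup>2) / (norm (x - \<zeta>))\<^sup>2"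

text \<open>The boundary map of an isometry of the hyperbolic ball that sends \<open>x\<close> to the centre; on the
  unit sphere it gives the direction of the gradient of the Poisson kernel at \<open>x\<close>.\<close>

definition ball_dir :: "'a::euclidean_space \<Rightarrow> 'a \<Rightarrow> 'a" where
  "ball_dir x \<zeta> = inversion x (1 - (norm x)\<^sup>2) \<zeta> - 2 *\<^sub>R x"

lemma measurable_ball_factor [measurable]: "ball_factor x \<in> borel_measurable borel"
  and measurable_ball_dir [measurable]: "ball_dir x \<in> borel_measurable borel"
  unfolding ball_factor_def ball_dir_def by measurable

lemma ball_dir_eq: "ball_dir x \<zeta> = - x + ball_factor x \<zeta> *\<^sub>R (\<zeta> - x)"
  by (simp add: ball_dir_def inversion_def ball_factor_def norm_minus_commute scaleR_2)

lemma norm_less_1_power2: "norm x < 1 \<Longrightarrow> 0 < 1 - (norm x)\<^sup>2"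
  by (simp add: power_less_one_iff abs_square_less_1)

lemma ball_factor_pos: "norm x < 1 \<Longrightarrow> norm \<zeta> = 1 \<Longrightarrow> 0 < ball_factor x \<zeta>"
  unfolding ball_factor_def using norm_less_1_power2[of x] by (intro divide_pos_pos) auto

lemma inner_sphere_point:
  assumes "norm \<zeta> = 1"
  shows "2 * (\<zeta> \<bullet> (\<zeta> - x)) = (norm (x - \<zeta>))\<^sup>2 + (1 - (norm x)\<^sup>2)"
  using assms unfolding norm_minus_commute[of x]
  by (simp add: power2_norm_eq_inner norm_eq_1 inner_diff_left inner_diff_right inner_commute)

text \<open>The reflected point is the second intersection of the sphere with the line through
  \<zeta> and x; the boundary map sends \<zeta> to the antipode of that point.\<close>

lemma ball_dir_reflect:
  assumes x: "norm x < 1" and \<zeta>: "norm \<zeta> = 1"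
  shows "ball_dir x \<zeta> = - reflect (\<zeta> - x) \<zeta>"
proof -
  have "x \<noteq> \<zeta>" using assms by auto
  then have nz: "(norm (x - \<zeta>))\<^sup>2 \<noteq> 0" by simp
  have "2 * (\<zeta> \<bullet> (\<zeta> - x)) / ((\<zeta> - x) \<bullet> (\<zeta> - x)) = 1 + ball_factor x \<zeta>"
    unfolding inner_sphere_point[OF \<zeta>] ball_factor_def
    using nz by (simp add: dot_square_norm norm_minus_commute add_divide_distrib)
  then show ?thesis
    by (simp add: reflect_def ball_dir_eq algebra_simps)
qed

lemma norm_ball_dir: "norm x < 1 \<Longrightarrow> norm \<zeta> = 1 \<Longrightarrow> norm (ball_dir x \<zeta>) = 1"
  by (simp add: ball_dir_reflect norm_reflect)

text \<open>The chord from \<zeta> through x ends at minus \<open>ball_dir x \<zeta>\<close>. Its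
  mirror image in the origin passes through -x and leads from \<open>ball_dir x \<zeta>\<close> to
  -\<zeta>, whose antipode is \<zeta>. In formulas, the two values of \<open>ball_factor\<close> are
  reciprocal.\<close>

lemma ball_dir_inverse:
  assumes x: "norm x < 1" and \<zeta>: "norm \<zeta> = 1"
  shows "ball_dir (- x) (ball_dir x \<zeta>) = \<zeta>"
proof -
  let ?k = "1 - (norm x)\<^sup>2"
  have k: "?k \<noteq> 0" using norm_less_1_power2[OF x] by simp
  have "\<zeta> \<noteq> x" using assms by auto
  then have nz: "(norm (x - \<zeta>))\<^sup>2 \<noteq> 0" by simp
  have "norm (- x - ball_dir x \<zeta>) = norm (ball_factor x \<zeta> *\<^sub>R (\<zeta> - x))"
    by (simp only: ball_dir_eq norm_minus_commute[of "- x"]) simp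
  then have "(norm (- x - ball_dir x \<zeta>))\<^sup>2 = (ball_factor x \<zeta>)\<^sup>2 * (norm (x - \<zeta>))\<^sup>2"
    by (simp add: power_mult_distrib norm_minus_commute)
  also have "\<dots> = ?k * ball_factor x \<zeta>"
    using nz by (simp add: ball_factor_def power2_eq_square)
  finally have "ball_factor (- x) (ball_dir x \<zeta>) * ball_factor x \<zeta> = 1"
    using k ball_factor_pos[OF x \<zeta>] by (simp add: ball_factor_def[of "- x"])
  moreover have "ball_dir x \<zeta> - (- x) = ball_factor x \<zeta> *\<^sub>R (\<zeta> - x)"
    by (simp add: ball_dir_eq)
  ultimately show ?thesis
    unfolding ball_dir_eq[of "- x"] by simp
qed

text \<open>Being reciprocal to the factor of the inverse map at \<eta> =
  \<open>ball_dir x \<zeta>\<close>, the factor is |\<eta> + x|^2 / (1 - |x|^2), and |\<eta>| = 1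
  makes this affine in \<eta>. The proof gets it by expanding \<eta> \<bullet> x.\<close>

lemma ball_factor_eq:
  assumes x: "norm x < 1" and \<zeta>: "norm \<zeta> = 1"
  shows "ball_factor x \<zeta> = (1 + (norm x)\<^sup>2 + 2 * (ball_dir x \<zeta> \<bullet> x)) / (1 - (norm x)\<^sup>2)"
proof -
  have k: "1 - (norm x)\<^sup>2 \<noteq> 0" using norm_less_1_power2[OF x] by simp
  have "2 * (ball_dir x \<zeta> \<bullet> x) = - 2 * (norm x)\<^sup>2 + ball_factor x \<zeta> * (2 * ((\<zeta> - x) \<bullet> x))"
    by (simp add: ball_dir_eq inner_add_left inner_diff_left power2_norm_eq_inner algebra_simps)
  also have "2 * ((\<zeta> - x) \<bullet> x) = (1 - (norm x)\<^sup>2) - (norm (x - \<zeta>))\<^sup>2"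
    using inner_sphere_point[OF \<zeta>, of x] unfolding norm_minus_commute[of x]
    by (simp add: power2_norm_eq_inner inner_diff_left inner_diff_right inner_commute)
  also have "ball_factor x \<zeta> * ((1 - (norm x)\<^sup>2) - (norm (x - \<zeta>))\<^sup>2)
      = ball_factor x \<zeta> * (1 - (norm x)\<^sup>2) - (1 - (norm x)\<^sup>2)"
    using assms by (auto simp: ball_factor_def right_diff_distrib)
  finally show ?thesis
    using k by (simp add: field_simps)
qed

text \<open>The homogeneous extension of the boundary map stretches by \<open>ball_factor\<close> tangentially and
  is isometric radially, so its Jacobian is the Poisson kernel.\<close>

definition cone_map :: "'a::euclidean_space \<Rightarrow> 'a \<Rightarrow> 'a" where
  "cone_map x y = norm y *\<^sub>R ball_dir x (y /\<^sub>R norm y)"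

lemma norm_sgn_1: "y \<noteq> 0 \<Longrightarrow> norm (y /\<^sub>R norm y) = 1" for y :: "'a::real_normed_vector"
  by simp

lemma norm_cone_map: "norm x < 1 \<Longrightarrow> norm (cone_map x y) = norm y"
  by (cases "y = 0") (simp_all add: cone_map_def norm_ball_dir)

lemma cone_map_radial: "norm x < 1 \<Longrightarrow> y \<noteq> 0 \<Longrightarrow> cone_map x y /\<^sub>R norm (cone_map x y) = ball_dir x (y /\<^sub>R norm y)"
  by (simp add: norm_cone_map) (simp add: cone_map_def)

lemma cone_map_inverse:
  assumes "norm x < 1" "y \<noteq> 0" shows "cone_map (- x) (cone_map x y) = y"
proof -
  have "cone_map (- x) (cone_map x y) =
      norm (cone_map x y) *\<^sub>R ball_dir (- x) (cone_map x y /\<^sub>R norm (cone_map x y))"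
    by (simp only: cone_map_def[of "- x"])
  also have "\<dots> = norm y *\<^sub>R (y /\<^sub>R norm y)"
    unfolding cone_map_radial[OF assms]
    by (simp only: norm_cone_map[OF assms(1)] ball_dir_inverse[OF assms(1) norm_sgn_1[OF assms(2)]])
  finally show ?thesis
    using assms(2) by simp
qed

text \<open>The derivative of y / |y| kills \<zeta>, so tangential vectors are stretched by the
  boundary map alone, and \<zeta> goes to \<open>ball_dir x \<zeta>\<close>. The latter is minus the
  reflection of \<zeta>, hence the radial factor -1.\<close>

lemma has_derivative_cone_map:
  assumes x: "norm x < 1" and y: "y \<noteq> 0"
  defines "\<zeta> \<equiv> y /\<^sub>R norm y"
  shows "(cone_map x has_derivative (\<lambda>h. reflect (\<zeta> - x)
    (ball_factor x \<zeta> *\<^sub>R h + ((- 1 - ball_factor x \<zeta>) * (\<zeta> \<bullet> h)) *\<^sub>R \<zeta>))) (at y)"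
proof -
  let ?R = "reflect (\<zeta> - x)" and ?f = "ball_factor x \<zeta>"
  have \<zeta>: "norm \<zeta> = 1" using y by (simp add: \<zeta>_def)
  have "\<zeta> \<noteq> x" using \<zeta> x by auto
  have dn: "(norm has_derivative (\<lambda>h. \<zeta> \<bullet> h)) (at y)"
    using has_derivative_norm[OF y] by (simp add: \<zeta>_def sgn_div_norm inner_commute)
  have "((\<lambda>y. y /\<^sub>R norm y) has_derivative (\<lambda>h. (1 / norm y) *\<^sub>R (h - (\<zeta> \<bullet> h) *\<^sub>R \<zeta>))) (at y)"
    using y dn by (auto intro!: derivative_eq_intros simp: fun_eq_iff \<zeta>_def field_simps)
  moreover have "(ball_dir x has_derivative (\<lambda>h. ?f *\<^sub>R ?R h)) (at \<zeta>)"
    unfolding ball_dir_def using has_derivative_diff[OF has_derivative_inversion[OF \<open>\<zeta> \<noteq> x\<close>] has_derivative_const]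
    by (simp add: ball_factor_def norm_minus_commute)
  ultimately have "((\<lambda>y. ball_dir x (y /\<^sub>R norm y)) has_derivative
      (\<lambda>h. ?f *\<^sub>R ?R ((1 / norm y) *\<^sub>R (h - (\<zeta> \<bullet> h) *\<^sub>R \<zeta>)))) (at y)"
    unfolding \<zeta>_def by (rule has_derivative_compose)
  from has_derivative_scaleR[OF dn this]
  have "(cone_map x has_derivative (\<lambda>h. norm y *\<^sub>R (?f *\<^sub>R ?R ((1 / norm y) *\<^sub>R (h - (\<zeta> \<bullet> h) *\<^sub>R \<zeta>)))
      + (\<zeta> \<bullet> h) *\<^sub>R ball_dir x \<zeta>)) (at y)"
    unfolding cone_map_def \<zeta>_def .
  moreover have "norm y *\<^sub>R (?f *\<^sub>R ?R ((1 / norm y) *\<^sub>R (h - (\<zeta> \<bullet> h) *\<^sub>R \<zeta>))) + (\<zeta> \<bullet> h) *\<^sub>R ball_dir x \<zeta>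
      = ?R (?f *\<^sub>R h + ((- 1 - ?f) * (\<zeta> \<bullet> h)) *\<^sub>R \<zeta>)" for h
  proof -
    have "h - (\<zeta> \<bullet> h) *\<^sub>R \<zeta> = h + (- (\<zeta> \<bullet> h)) *\<^sub>R \<zeta>" by simp
    then show ?thesis
      using y unfolding ball_dir_reflect[OF x \<zeta>]
      by (simp only: reflect_add reflect_scaleR) (simp add: algebra_simps)
  qed
  ultimately show ?thesis by simp
qed

text \<open>The cone map preserves norms and so permutes the punctured ball, its inverse being the
  cone map of -x; its Jacobian is exactly the kernel factor in the integrand.\<close>

lemma integral_ball_dir:
  fixes x :: "'a::euclidean_space"
  assumes x: "norm x < 1" and [measurable]: "G \<in> borel_measurable borel"
  shows "(\<integral>\<zeta>. ball_factor x \<zeta> ^ (DIM('a) - 1) * G (ball_dir x \<zeta>) \<partial>radial_measure) = (\<integral>\<zeta>. G \<zeta> \<partial>radial_measure)"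
proof -
  let ?S = "ball (0 :: 'a) 1 - {0}"
  let ?n = "\<lambda>y :: 'a. y /\<^sub>R norm y"
  have maps: "cone_map z y \<in> ?S" if "norm z < 1" "y \<in> ?S" for z y :: 'a
    using that norm_cone_map[OF that(1), of y] by auto
  have "(LINT y:?S|lborel. ball_factor x (?n y) ^ (DIM('a) - 1) * G (ball_dir x (?n y))) =
      (LINT y:?S|lborel. \<bar>ball_factor x (?n y)\<bar> ^ (DIM('a) - 1) * \<bar>- 1\<bar> * G (?n (cone_map x y)))"
    using x by (intro set_lebesgue_integral_cong) (auto simp: cone_map_radial ball_factor_pos less_imp_le)
  also have "\<dots> = (LINT y:?S|lborel. G (?n y))"
  proof (rule change_of_variables_dilation(2)[where z = ?n and Q = "\<lambda>y. reflect (?n y - x)"])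
    show "cone_map x ` ?S = ?S"
    proof (intro equalityI subsetI)
      fix y assume y: "y \<in> ?S"
      then show "y \<in> cone_map x ` ?S"
        using x maps[of "- x" y] cone_map_inverse[of "- x" y] by (intro image_eqI[of _ _ "cone_map (- x) y"]) auto
    qed (use maps x in auto)
    show "inj_on (cone_map x) ?S"
      by (rule inj_on_inverseI[where g = "cone_map (- x)"]) (simp add: cone_map_inverse x)
    show "cone_map x \<in> borel_measurable borel"
      unfolding cone_map_def by measurable
    show "(cone_map x has_derivative (\<lambda>h. reflect (?n y - x)
        (ball_factor x (?n y) *\<^sub>R h + ((- 1 - ball_factor x (?n y)) * (?n y \<bullet> h)) *\<^sub>R ?n y))) (at y)" if "y \<in> ?S" for y
      using that by (intro has_derivative_cone_map x) auto
  qed (auto simp: orthogonal_transformation_reflect)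
  finally show ?thesis
    by (simp add: integral_radial_measure)
qed

section \<open>Gradient of the Poisson integral on the ball\<close>

definition ball_grad :: "'a::euclidean_space \<Rightarrow> 'a \<Rightarrow> 'a" where
  "ball_grad x \<zeta> = (2 * real (DIM('a) - 1) / (1 - (norm x)\<^sup>2) * ball_factor x \<zeta> ^ (DIM('a) - 1)) *\<^sub>R ball_dir x \<zeta>"

lemma measurable_ball_grad [measurable]: "ball_grad x \<in> borel_measurable borel"
  unfolding ball_grad_def by measurable

lemma norm_ball_grad:
  fixes x :: "'a::euclidean_space"
  assumes "norm x < 1" "norm \<zeta> = 1"
  shows "norm (ball_grad x \<zeta>) = 2 * real (DIM('a) - 1) / (1 - (norm x)\<^sup>2) * ball_factor x \<zeta> ^ (DIM('a) - 1)"
  using ball_factor_pos[OF assms] norm_less_1_power2[OF assms(1)] by (simp add: ball_grad_def norm_ball_dir[OF assms] abs_mult)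

lemma GDERIV_ball_factor_power:
  fixes z :: "'a::euclidean_space"
  assumes z: "norm z < 1" and \<zeta>: "norm \<zeta> = 1"
  shows "GDERIV (\<lambda>z. ball_factor z \<zeta> ^ (DIM('a) - 1)) z :> ball_grad z \<zeta>"
proof -
  let ?d = "(z - \<zeta>) \<bullet> (z - \<zeta>)" and ?k = "1 - z \<bullet> z"
  have "z \<noteq> \<zeta>" using assms by auto
  then have d: "?d \<noteq> 0"
    using inner_eq_zero_iff[of "z - \<zeta>"] by (metis right_minus_eq)
  have k: "?k \<noteq> 0" using norm_less_1_power2[OF z] by (simp add: power2_norm_eq_inner)
  have factor: "ball_factor z \<zeta> = (1 - z \<bullet> z) / ((z - \<zeta>) \<bullet> (z - \<zeta>))" for z :: 'a
    by (simp only: ball_factor_def power2_norm_eq_inner)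
  have "((\<lambda>z. (1 - z \<bullet> z) / ((z - \<zeta>) \<bullet> (z - \<zeta>))) has_derivative
      (\<lambda>h. (- (2 * (h \<bullet> z)) * ?d - ?k * (2 * (h \<bullet> (z - \<zeta>)))) / (?d * ?d))) (at z)"
    using d by (auto intro!: derivative_eq_intros simp: fun_eq_iff inner_commute)
  moreover have "(- (2 * (h \<bullet> z)) * ?d - ?k * (2 * (h \<bullet> (z - \<zeta>)))) / (?d * ?d)
      = h \<bullet> ((2 / ?k * (?k / ?d)) *\<^sub>R ball_dir z \<zeta>)" for h
  proof -
    have "h \<bullet> ball_dir z \<zeta> = - (h \<bullet> z) - ?k / ?d * (h \<bullet> (z - \<zeta>))"
    proof -
      have "h \<bullet> (\<zeta> - z) = - (h \<bullet> (z - \<zeta>))"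
        by (simp add: inner_diff_right)
      then show ?thesis
        unfolding ball_dir_eq factor
        by (simp only: inner_add_right inner_minus_right inner_scaleR_right mult_minus_right add_uminus_conv_diff)
    qed
    moreover have "(- (2 * b) * D - K * (2 * X)) / (D * D) = 2 / K * (K / D) * (- b - K / D * X)"
      if "K \<noteq> 0" "D \<noteq> 0" for b D K X :: real
      using that by (simp add: field_simps)
    ultimately show ?thesis
      unfolding inner_scaleR_right using k d by metis
  qed
  ultimately have "GDERIV (\<lambda>z. ball_factor z \<zeta>) z :> (2 / ?k * ball_factor z \<zeta>) *\<^sub>R ball_dir z \<zeta>"
    unfolding gderiv_def factor by simp
  moreover have "DERIV (\<lambda>r. r ^ (DIM('a) - 1)) (ball_factor z \<zeta>) :>
      real (DIM('a) - 1) * ball_factor z \<zeta> ^ (DIM('a) - 1 - 1)"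
    by (auto intro!: derivative_eq_intros)
  ultimately have "GDERIV (\<lambda>z. ball_factor z \<zeta> ^ (DIM('a) - 1)) z :>
      (real (DIM('a) - 1) * ball_factor z \<zeta> ^ (DIM('a) - 1 - 1)) *\<^sub>R (2 / ?k * ball_factor z \<zeta>) *\<^sub>R ball_dir z \<zeta>"
    by (rule GDERIV_DERIV_compose)
  \<comment> \<open>For m = 0 the exponent m - 1 is truncated, but both sides vanish.\<close>
  moreover have "real m * r ^ (m - 1) * (2 / K * r) = 2 * real m / K * r ^ m" for m and r K :: real
    by (cases m) simp_all
  ultimately show ?thesis
    unfolding ball_grad_def scaleR_scaleR by (simp only: power2_norm_eq_inner)
qed

lemma gradient_poisson_ball:
  fixes x :: "'a::euclidean_space"
  assumes x: "norm x < 1" and q: "1 < q" and \<phi>: "\<phi> \<in> Lp_space sphere_measure (conj_exp q)"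
  shows "gradient (poisson_ball \<phi>) x = (\<integral>\<zeta>. \<phi> \<zeta> *\<^sub>R ball_grad x \<zeta> \<partial>sphere_measure)"
proof (rule gradient_eqI)
  interpret finite_measure "sphere_measure :: 'a measure" by (rule finite_measure_sphere_measure)
  let ?M = "sphere_measure :: 'a measure" and ?N = "DIM('a) - 1"
  \<comment> \<open>Half the distance from x to the sphere: points of \<open>ball x r\<close> stay
    at distance at least r from it, which bounds kernel and gradients by constants.\<close>
  define r where "r = (1 - norm x) / 2"
  have r: "0 < r" using x by (simp add: r_def)
  have near: "norm z < 1" "r \<le> 1 - (norm z)\<^sup>2" "\<And>\<zeta>. norm \<zeta> = 1 \<Longrightarrow> r \<le> norm (z - \<zeta>)" if "z \<in> ball x r" for z
  proof -
    have "norm z \<le> norm x + norm (z - x)"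
      using norm_triangle_ineq[of x "z - x"] by simp
    then have z: "norm z \<le> 1 - r"
      using that by (simp add: dist_norm norm_minus_commute r_def field_simps)
    then show "norm z < 1" using r by simp
    then have "(norm z)\<^sup>2 \<le> norm z * 1"
      unfolding power2_eq_square by (intro mult_left_mono) auto
    then show "r \<le> 1 - (norm z)\<^sup>2" using z by simp
    show "r \<le> norm (z - \<zeta>)" if "norm \<zeta> = 1" for \<zeta>
      using norm_triangle_ineq2[of \<zeta> z] z that by (simp add: norm_minus_commute)
  qed
  have factor_le: "ball_factor z \<zeta> \<le> 1 / r\<^sup>2" if z: "z \<in> ball x r" and \<zeta>: "norm \<zeta> = 1" for z \<zeta>
    unfolding ball_factor_def
    using near[OF z] \<zeta> r by (intro frac_le power_mono) auto
  \<comment> \<open>The surface measure is finite, so a constant majorant is integrable against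
    \<phi>.\<close>
  have const: "(\<lambda>_. c) \<in> Lp_space ?M q" for c :: real
    by (intro Lp_spaceI) simp_all
  have \<phi>_meas: "\<phi> \<in> borel_measurable ?M" using \<phi> by (simp add: Lp_space_def)
  have factor_meas: "(\<lambda>\<zeta>. ball_factor z \<zeta> ^ ?N) \<in> borel_measurable ?M" for z
    by (rule measurable_sphere_measure) measurable
  have "(\<lambda>\<zeta>. ball_factor x \<zeta> ^ ?N) \<in> Lp_space ?M q"
  proof (rule Lp_spaceI[OF factor_meas])
    show "integrable ?M (\<lambda>\<zeta>. \<bar>ball_factor x \<zeta> ^ ?N\<bar> powr q)"
    proof (rule integrable_const_bound[where B = "((1 / r\<^sup>2) ^ ?N) powr q"])
      show "AE \<zeta> in ?M. norm (\<bar>ball_factor x \<zeta> ^ ?N\<bar> powr q) \<le> ((1 / r\<^sup>2) ^ ?N) powr q"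
        using factor_le[of x] ball_factor_pos[OF x] r q
        by (intro AE_I2) (auto simp: space_sphere_measure less_imp_le intro!: powr_mono2 power_mono)
    qed (use factor_meas in measurable)
  qed
  note int = Lp_mult_integrable[OF q \<phi> this] Lp_mult_integrable[OF q \<phi> const]
  have "poisson_ball \<phi> = (\<lambda>z. \<integral>\<zeta>. ball_factor z \<zeta> ^ ?N * \<phi> \<zeta> \<partial>?M)"
    by (simp add: poisson_ball_def ball_factor_def fun_eq_iff)
  moreover have "GDERIV (\<lambda>z. \<integral>\<zeta>. ball_factor z \<zeta> ^ ?N * \<phi> \<zeta> \<partial>?M) x :> (\<integral>\<zeta>. \<phi> \<zeta> *\<^sub>R ball_grad x \<zeta> \<partial>?M)"
  proof (rule GDERIV_integral[OF r, where B = "\<lambda>_. 2 * real ?N / r * (1 / r\<^sup>2) ^ ?N"])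
    fix z \<zeta> assume z: "z \<in> ball x r" and "\<zeta> \<in> space ?M"
    then have \<zeta>: "norm \<zeta> = 1" by (simp add: space_sphere_measure)
    show "GDERIV (\<lambda>z. ball_factor z \<zeta> ^ ?N) z :> ball_grad z \<zeta>"
      by (rule GDERIV_ball_factor_power[OF near(1)[OF z] \<zeta>])
    show "norm (ball_grad z \<zeta>) \<le> 2 * real ?N / r * (1 / r\<^sup>2) ^ ?N"
      unfolding norm_ball_grad[OF near(1)[OF z] \<zeta>]
      using near(2)[OF z] factor_le[OF z \<zeta>] ball_factor_pos[OF near(1)[OF z] \<zeta>] r
      by (intro mult_mono divide_left_mono power_mono) auto
  next
    show "integrable ?M (\<lambda>\<zeta>. 2 * real ?N / r * (1 / r\<^sup>2) ^ ?N * \<phi> \<zeta>)"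
      using int(2)[of "2 * real ?N / r * (1 / r\<^sup>2) ^ ?N"] by (simp only: mult.commute)
    show "integrable ?M (\<lambda>\<zeta>. ball_factor x \<zeta> ^ ?N * \<phi> \<zeta>)"
      using int(1) by (simp only: mult.commute)
    show "ball_grad x \<in> borel_measurable ?M"
      by (rule measurable_sphere_measure) measurable
  qed (use factor_meas \<phi>_meas in simp_all)
  ultimately show "GDERIV (poisson_ball \<phi>) x :> (\<integral>\<zeta>. \<phi> \<zeta> *\<^sub>R ball_grad x \<zeta> \<partial>?M)"
    by simp
qed

text \<open>By \<open>ball_factor_eq\<close> the weight is affine in z \<bullet> e with A = 1 +
  |x|^2 and B = 2 |x|; the condition |B| \<le> A is (1 - |x|)^2 \<ge> 0.\<close>

lemma C_ball_extremal:
  fixes x l t :: "'a::euclidean_space" and q :: real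
  assumes q: "1 < q" "real (DIM('a) - 1) * (q - 1) \<le> 1" and dim: "1 < DIM('a)"
    and x: "norm x < 1" "x \<noteq> 0" and l: "norm l = 1" and t: "norm t = 1" "t \<bullet> (x /\<^sub>R norm x) = 0"
  shows "C_ball_dir q x (x /\<^sub>R norm x) \<le> C_ball_dir q x l \<and>
    C_ball_dir q x (- (x /\<^sub>R norm x)) \<le> C_ball_dir q x l \<and>
    C_ball_dir q x l \<le> C_ball_dir q x t \<and>
    C_ball_dir q x t = C_ball q x"
  unfolding C_ball_dir_def C_ball_def
proof (rule grad_const_extremal[where H = "ball_grad x" and N = radial_measure and
      A = "1 + (norm x)\<^sup>2" and B = "2 * norm x" and a = "real (DIM('a) - 1) * (q - 1)" and S = "sphere 0 1" and
      k = "(2 * real (DIM('a) - 1) / (1 - (norm x)\<^sup>2)) powr q *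
        (1 / (1 - (norm x)\<^sup>2)) powr (real (DIM('a) - 1) * (q - 1))"])
  let ?N = "DIM('a) - 1" and ?k = "1 - (norm x)\<^sup>2" and ?e = "x /\<^sub>R norm x"
  let ?a = "real ?N * (q - 1)"
  let ?C = "2 * real ?N / ?k"
  interpret finite_measure "sphere_measure :: 'a measure" by (rule finite_measure_sphere_measure)
  have k: "0 < ?k" by (rule norm_less_1_power2[OF x(1)])
  show meas: "ball_grad x \<in> borel_measurable sphere_measure"
    by (rule measurable_sphere_measure) measurable
  define b where "b = (1 - norm x)"
  have b: "0 < b" using x by (simp add: b_def)
  have factor_le: "ball_factor x \<zeta> \<le> ?k / b\<^sup>2" if "norm \<zeta> = 1" for \<zeta>
  proof -
    have "b \<le> norm (x - \<zeta>)"
      using norm_triangle_ineq2[of \<zeta> x] that by (simp add: b_def norm_minus_commute)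
    then show ?thesis
      unfolding ball_factor_def using b k by (intro divide_left_mono power_mono mult_pos_pos) auto
  qed
  show "integrable sphere_measure (\<lambda>\<zeta>. norm (ball_grad x \<zeta>) powr q)"
  proof (rule integrable_const_bound[where B = "(?C * (?k / b\<^sup>2) ^ ?N) powr q"])
    show "AE \<zeta> in sphere_measure. norm (norm (ball_grad x \<zeta>) powr q) \<le> (?C * (?k / b\<^sup>2) ^ ?N) powr q"
    proof (rule AE_I2)
      fix \<zeta> :: 'a assume "\<zeta> \<in> space sphere_measure"
      then have \<zeta>: "norm \<zeta> = 1" by (simp add: space_sphere_measure)
      have "norm (ball_grad x \<zeta>) \<le> ?C * (?k / b\<^sup>2) ^ ?N"
        unfolding norm_ball_grad[OF x(1) \<zeta>]
        using factor_le[OF \<zeta>] ball_factor_pos[OF x(1) \<zeta>] k by (intro mult_left_mono power_mono) auto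
      then show "norm (norm (ball_grad x \<zeta>) powr q) \<le> (?C * (?k / b\<^sup>2) ^ ?N) powr q"
        using q by (simp add: powr_mono2)
    qed
  qed (use meas in measurable)
  show "sphere 0 1 \<in> sets (sphere_measure :: 'a measure)"
    by (metis sets.top space_sphere_measure)
  have B: "2 * norm x \<le> 1 + (norm x)\<^sup>2"
    using zero_le_power2[of "1 - norm x"] by (simp add: power2_diff)
  then show "\<bar>2 * norm x\<bar> \<le> 1 + (norm x)\<^sup>2" by simp
  show "(\<integral>\<zeta>. \<bar>ball_grad x \<zeta> \<bullet> l\<bar> powr q \<partial>sphere_measure) =
      ?C powr q * (1 / ?k) powr ?a *
      (\<integral>z. (1 + (norm x)\<^sup>2 + 2 * norm x * (z \<bullet> ?e)) powr ?a * \<bar>z \<bullet> l\<bar> powr q \<partial>radial_measure)" for l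
  proof -
    let ?G = "\<lambda>z. (1 + (norm x)\<^sup>2 + 2 * norm x * (z \<bullet> ?e)) powr ?a * \<bar>z \<bullet> l\<bar> powr q"
    have eq: "\<bar>ball_grad x \<zeta> \<bullet> l\<bar> powr q = ?C powr q * (1 / ?k) powr ?a * (ball_factor x \<zeta> ^ ?N * ?G (ball_dir x \<zeta>))"
      if \<zeta>: "norm \<zeta> = 1" for \<zeta>
    proof -
      let ?f = "ball_factor x \<zeta>"
      have f: "0 < ?f" by (rule ball_factor_pos[OF x(1) \<zeta>])
      have "\<bar>ball_grad x \<zeta> \<bullet> l\<bar> = ?C * (?f ^ ?N * \<bar>ball_dir x \<zeta> \<bullet> l\<bar>)"
        using f k by (simp add: ball_grad_def abs_mult)
      then have 1: "\<bar>ball_grad x \<zeta> \<bullet> l\<bar> powr q = ?C powr q * ((?f ^ ?N) powr q * \<bar>ball_dir x \<zeta> \<bullet> l\<bar> powr q)"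
        by (simp only: powr_mult)
      \<comment> \<open>The first factor is the Jacobian that \<open>integral_ball_dir\<close> will
        absorb; the second becomes the weight.\<close>
      have "(?f ^ ?N) powr q = (?f ^ ?N) powr 1 * (?f ^ ?N) powr (q - 1)"
        by (subst powr_add[symmetric]) simp
      also have "\<dots> = ?f ^ ?N * ?f powr ?a"
        using f by (simp add: powr_powr flip: powr_realpow)
      also have "?f powr ?a = (1 / ?k * (1 + (norm x)\<^sup>2 + 2 * norm x * (ball_dir x \<zeta> \<bullet> ?e))) powr ?a"
      proof -
        have "2 * norm x * (ball_dir x \<zeta> \<bullet> ?e) = 2 * (ball_dir x \<zeta> \<bullet> x)"
          using x by (simp add: field_simps)
        then show ?thesis
          by (simp only: ball_factor_eq[OF x(1) \<zeta>] times_divide_eq_left mult_1)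
      qed
      also have "\<dots> = (1 / ?k) powr ?a * (1 + (norm x)\<^sup>2 + 2 * norm x * (ball_dir x \<zeta> \<bullet> ?e)) powr ?a"
        by (rule powr_mult)
      finally show ?thesis
        unfolding 1 by (simp only: ac_simps)
    qed
    have "(\<integral>\<zeta>. \<bar>ball_grad x \<zeta> \<bullet> l\<bar> powr q \<partial>sphere_measure) =
        (\<integral>\<zeta>. ?C powr q * (1 / ?k) powr ?a * (ball_factor x \<zeta> ^ ?N * ?G (ball_dir x \<zeta>)) \<partial>sphere_measure)"
      by (intro Bochner_Integration.integral_cong eq refl) (simp add: space_sphere_measure)
    also have "\<dots> = ?C powr q * (1 / ?k) powr ?a *
        (\<integral>\<zeta>. ball_factor x \<zeta> ^ ?N * ?G (ball_dir x \<zeta>) \<partial>sphere_measure)"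
      by (rule integral_mult_right_zero)
    also have "(\<integral>\<zeta>. ball_factor x \<zeta> ^ ?N * ?G (ball_dir x \<zeta>) \<partial>sphere_measure) =
        (\<integral>\<zeta>. ball_factor x \<zeta> ^ ?N * ?G (ball_dir x \<zeta>) \<partial>radial_measure)"
      by (rule integral_sphere_measure) measurable
    also have "\<dots> = (\<integral>z. ?G z \<partial>radial_measure)"
      by (rule integral_ball_dir[OF x(1)]) measurable
    finally show ?thesis .
  qed
  show "norm ?e = 1" using x by simp
  show "0 < ?a" using q dim by simp
qed (use q x l t in \<open>simp_all add: gradient_poisson_ball finite_measure_radial_measure AE_norm_radial_measure
    reflect_radial_measure sets_radial_measure measure_sphere_measure_pos\<close>)

text \<open>The type \<open>'m\<close> indexes the boundary R^(n-1), so
  \<open>(real^'m) \<times> real\<close> is R^n with the last coordinate split off, and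
  \<open>(0, 1)\<close> is e_n.\<close>

theorem theorem1p1:
  fixes n :: nat and q :: real
  assumes "n \<ge> 3" and "1 < q" and "q < real n / (real n - 1)"
    and "CARD('n::finite) = n" and "CARD('m::finite) + 1 = n"
  shows "(\<forall>(x::real^'n) l t. x \<in> ball 0 1 - {0} \<longrightarrow> norm l = 1 \<longrightarrow>
            norm t = 1 \<longrightarrow> t \<bullet> (x /\<^sub>R norm x) = 0 \<longrightarrow>
            C_ball_dir q x (x /\<^sub>R norm x) \<le> C_ball_dir q x l \<and>
            C_ball_dir q x (- (x /\<^sub>R norm x)) \<le> C_ball_dir q x l \<and>
            C_ball_dir q x l \<le> C_ball_dir q x t \<and>
            C_ball_dir q x t = C_ball q x)
       \<and> (\<forall>(x::(real^'m) \<times> real) l t. x \<in> upper_halfspace \<longrightarrow> norm l = 1 \<longrightarrow>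
            norm t = 1 \<longrightarrow> t \<bullet> (0, 1) = 0 \<longrightarrow>
            C_halfspace_dir q x (0, 1) \<le> C_halfspace_dir q x l \<and>
            C_halfspace_dir q x (- (0, 1)) \<le> C_halfspace_dir q x l \<and>
            C_halfspace_dir q x l \<le> C_halfspace_dir q x t \<and>
            C_halfspace_dir q x t = C_halfspace q x)"
proof -
  \<comment> \<open>Subtracting n - 1 turns this into (n - 1) (q - 1) < 1, the bound on the exponent
    a in both geometries.\<close>
  have "(real n - 1) * q < real n"
    using assms(1,3) by (simp add: less_divide_eq mult.commute)
  then have a: "(real n - 1) * (q - 1) \<le> 1"
    by (simp add: algebra_simps)
  show ?thesis
  proof (rule conjI; intro allI impI)
    fix x l t :: "real^'n"
    assume "x \<in> ball 0 1 - {0}" "norm l = 1" "norm t = 1" "t \<bullet> (x /\<^sub>R norm x) = 0"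
    then show "C_ball_dir q x (x /\<^sub>R norm x) \<le> C_ball_dir q x l \<and>
        C_ball_dir q x (- (x /\<^sub>R norm x)) \<le> C_ball_dir q x l \<and>
        C_ball_dir q x l \<le> C_ball_dir q x t \<and>
        C_ball_dir q x t = C_ball q x"
      using assms a by (intro C_ball_extremal) (simp_all add: of_nat_diff)
  next
    fix x l t :: "(real^'m) \<times> real"
    assume "x \<in> upper_halfspace" "norm l = 1" "norm t = 1" "t \<bullet> (0, 1) = 0"
    then show "C_halfspace_dir q x (0, 1) \<le> C_halfspace_dir q x l \<and>
        C_halfspace_dir q x (- (0, 1)) \<le> C_halfspace_dir q x l \<and>
        C_halfspace_dir q x l \<le> C_halfspace_dir q x t \<and>
        C_halfspace_dir q x t = C_halfspace q x"
      using assms(2) a unfolding assms(5)[symmetric]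
      by (intro C_halfspace_extremal) (simp_all add: upper_halfspace_def)
  qed
qed

end
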